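(* Let $q\ge1$ be an integer, $\theta\in(0,1)$, $\varepsilon\ge0$, and let $(y_t)_{1\le t\le n}$, $n\ge1$, be a signal time series in $\mathbb R^q$ with block second moments $\widehat\Sigma_{a:b}$. Assume there are positive semidefinite matrices $\Sigma_\le\ne\Sigma_>$ in $\mathbb R^{q\times q}$ such that for all $0\le a_1<b_1\le\theta$ and all $\theta\le a_2<b_2\le1$, $$\lim_{n\to\infty}\widehat\Sigma_{a_1:b_1}=\Sigma_\le,\qquad \lim_{n\to\infty}\widehat\Sigma_{a_2:b_2}=\Sigma_>.$$ If $\varepsilon=0$, assume additionally that $m>0$. With $M,m,J_n,J_\infty,\mathcal D_n,\mathcal D_n(\delta)$ as in the context: (i) The limiting objective $J_\infty$ is strictly concave on $(0,\theta)$ and on $(\theta,1)$ and has a cusp at its unique minimizer $\theta$; more precisely, for all $\nu\in[0,1]$, $$J_\infty(\nu)-J_\infty(\theta)\ \ge\ \frac{\min\{\theta,1-\theta\}}{2(M+\varepsilon)^2}\,\|\Sigma_>-\Sigma_\le\|_F^2\,|\nu-\theta|.$$ (ii) If $\varepsilon>0$, then $\lim_{n\to\infty}\sup_{\nu\in\mathcal D_n}|J_n(\nu)-J_\infty(\nu)|=0$. If $\varepsilon=0$, then for every $0<\delta<\frac12$, $\lim_{n\to\infty}\sup_{\nu\in\mathcal D_n(\delta)}|J_n(\nu)-J_\infty(\nu)|=0$. (iii) If $\varepsilon>0$, every sequence of untrimmed estimators $\hat\theta_n\in\arg\min_{\nu\in\mathcal D_n}J_n(\nu)$ satisfies $\lim_{n\to\infty}\hat\theta_n=\theta$.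 If $\varepsilon=0$ and $\delta\in(0,\min\{\theta,1-\theta\})$, every sequence of trimmed estimators $\hat\theta_{n,\delta}\in\arg\min_{\nu\in\mathcal D_n(\delta)}J_n(\nu)$ satisfies $\lim_{n\to\infty}\hat\theta_{n,\delta}=\theta$.
   Context: Signal series. For each $n\ge 1$, $y_1,\dots,y_n\in\mathbb R^q$ are given deterministic vectors (they may depend on $n$; no stochastic model is imposed). Blocks. For $0\le a<b\le1$ let $I(a,b)=\{\lfloor an\rfloor+1,\dots,\lfloor bn\rfloor\}$ and, when nonempty, $\widehat\Sigma_{a:b}=\frac{1}{|I(a,b)|}\sum_{t\in I(a,b)}y_ty_t^{\top}$ (depending on $n$). $\|\cdot\|$ is the operator norm, $\|\cdot\|_F$ the Frobenius norm, $\lambda_{\min}$ the smallest eigenvalue. Spectral bounds. $\mathcal I_\theta^{\rm br}=\{I(s,\theta):0\le s<\theta\}\cup\{I(\theta,s):\theta<s\le1\}$, $\mathcal I_\theta^{\rm cut}=\mathcal I_\theta^{\rm br}\cup\{I(0,s):0<s<\theta\}\cup\{I(s,1):\theta<s<1\}$ (indexed by the fractions $(a,b)$); $M:=\sup_{I(a,b)\in\mathcal I_\theta^{\rm br}}\limsup_{n\to\infty}\|\widehat\Sigma_{a:b}\|$, $m:=\inf_{I(a,b)\in\mathcal I_\theta^{\rm cut}}\liminf_{n\to\infty}\lambda_{\min}(\widehat\Sigma_{a:b})$. (Under the convergence assumption of the claim, $M=\max\{\|\Sigma_\le\|,\|\Sigma_>\|\}<\infty$ and $m=\min\{\lambda_{\min}(\Sigma_\le),\lambda_{\min}(\Sigma_>)\}$.)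 QML objective. For $\nu\in(0,1)$ with $1\le\lfloor\nu n\rfloor\le n-1$, $$J_n(\nu):=\nu\log\det(\widehat\Sigma_{0:\nu}+\varepsilon I_q)+(1-\nu)\log\det(\widehat\Sigma_{\nu:1}+\varepsilon I_q),$$ with $\log0=-\infty$. Grids: $\mathcal D_n=\{k/n:1\le k\le n-1\}$, $\mathcal D_n(\delta)=\mathcal D_n\cap[\delta,1-\delta]$. Limiting objective. For $\nu\in(0,1)$: $\Sigma_{0:\nu}:=\Sigma_\le$ if $\nu\le\theta$ and $\Sigma_{0:\nu}:=\frac{\theta}{\nu}\Sigma_\le+\frac{\nu-\theta}{\nu}\Sigma_>$ if $\nu>\theta$; $\Sigma_{\nu:1}:=\frac{\theta-\nu}{1-\nu}\Sigma_\le+\frac{1-\theta}{1-\nu}\Sigma_>$ if $\nu<\theta$ and $\Sigma_{\nu:1}:=\Sigma_>$ if $\nu\ge\theta$; $$J_\infty(\nu):=\nu\log\det(\Sigma_{0:\nu}+\varepsilon I_q)+(1-\nu)\log\det(\Sigma_{\nu:1}+\varepsilon I_q),$$ with the values $J_\infty(0)$, $J_\infty(1)$ defined by continuous extension. *)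

theory Defs
  imports "HOL-Analysis.Analysis"
begin

text \<open>
  The signal is a triangular array: \<open>y n t\<close> is the vector \<open>y\<^sub>t\<close> of the series of length
  \<open>n\<close>; only \<open>1 \<le> t \<le> n\<close> is ever used. Blocks are indexed by their fractions \<open>(a, b)\<close>.
\<close>

definition block :: "nat \<Rightarrow> real \<Rightarrow> real \<Rightarrow> nat set" where
  "block n a b = {nat \<lfloor>a * real n\<rfloor> + 1 .. nat \<lfloor>b * real n\<rfloor>}"

definition outer_square :: "real^'q \<Rightarrow> real^'q^'q" where
  "outer_square v = (\<chi> i j. v $ i * v $ j)"

text \<open>On an empty block (for given \<open>a < b\<close>, only finitely many \<open>n\<close>) the value is \<open>0\<close>.\<close>

definition Sigma_hat :: "(nat \<Rightarrow> nat \<Rightarrow> real^'q::finite) \<Rightarrow> nat \<Rightarrow> real \<Rightarrow> real \<Rightarrow> real^'q^'q" where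
  "Sigma_hat y n a b =
     (1 / real (card (block n a b))) *\<^sub>R (\<Sum>t\<in>block n a b. outer_square (y n t))"

definition psd :: "real^'q::finite^'q \<Rightarrow> bool" where
  "psd A \<longleftrightarrow> transpose A = A \<and> (\<forall>x. 0 \<le> x \<bullet> (A *v x))"

definition op_norm :: "real^'q::finite^'q \<Rightarrow> real" where
  "op_norm A = onorm (\<lambda>x. A *v x)"

definition eigenvalue :: "real^'q::finite^'q \<Rightarrow> real \<Rightarrow> bool" where
  "eigenvalue A l \<longleftrightarrow> (\<exists>v. v \<noteq> 0 \<and> A *v v = l *\<^sub>R v)"

text \<open>Only applied to symmetric matrices, for which real eigenvalues exist.\<close>

definition lambda_min :: "real^'q::finite^'q \<Rightarrow> real" where
  "lambda_min A = (LEAST l. eigenvalue A l)"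

text \<open>The library norm on \<^typ>\<open>real^'q^'q\<close> is the Frobenius norm.\<close>

lemma norm_eq_frobenius:
  fixes A :: "real^'q::finite^'q"
  shows "norm A = sqrt (\<Sum>i\<in>UNIV. \<Sum>j\<in>UNIV. (A $ i $ j)\<^sup>2)"
  by (simp add: norm_vec_def L2_set_def sum_nonneg)

definition I_br :: "real \<Rightarrow> (real \<times> real) set" where
  "I_br \<theta> = {(s, \<theta>) | s. 0 \<le> s \<and> s < \<theta>} \<union> {(\<theta>, s) | s. \<theta> < s \<and> s \<le> 1}"

definition I_cut :: "real \<Rightarrow> (real \<times> real) set" where
  "I_cut \<theta> = I_br \<theta> \<union> {(0, s) | s. 0 < s \<and> s < \<theta>} \<union> {(s, 1) | s. \<theta> < s \<and> s < 1}"

definition M_bound :: "(nat \<Rightarrow> nat \<Rightarrow> real^'q::finite) \<Rightarrow> real \<Rightarrow> ereal" where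
  "M_bound y \<theta> = (SUP (a, b) \<in> I_br \<theta>. limsup (\<lambda>n. ereal (op_norm (Sigma_hat y n a b))))"

definition m_bound :: "(nat \<Rightarrow> nat \<Rightarrow> real^'q::finite) \<Rightarrow> real \<Rightarrow> ereal" where
  "m_bound y \<theta> = (INF (a, b) \<in> I_cut \<theta>. liminf (\<lambda>n. ereal (lambda_min (Sigma_hat y n a b))))"

text \<open>
  The convention \<open>log 0 = -\<infinity>\<close> makes the finite-sample objective extended-real valued. The value
  at negative determinants is irrelevant, since all matrices below are positive semidefinite.
\<close>

definition log_det :: "real^'q::finite^'q \<Rightarrow> ereal" where
  "log_det A = (if det A \<le> 0 then -\<infinity> else ereal (ln (det A)))"

definition J_n :: "(nat \<Rightarrow> nat \<Rightarrow> real^'q::finite) \<Rightarrow> real \<Rightarrow> nat \<Rightarrow> real \<Rightarrow> ereal" where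
  "J_n y \<epsilon> n \<nu> =
     ereal \<nu> * log_det (Sigma_hat y n 0 \<nu> + \<epsilon> *\<^sub>R mat 1)
     + ereal (1 - \<nu>) * log_det (Sigma_hat y n \<nu> 1 + \<epsilon> *\<^sub>R mat 1)"

definition grid :: "nat \<Rightarrow> real set" where
  "grid n = {real k / real n | k. 1 \<le> k \<and> k < n}"

definition trimmed_grid :: "real \<Rightarrow> nat \<Rightarrow> real set" where
  "trimmed_grid \<delta> n = grid n \<inter> {\<delta> .. 1 - \<delta>}"

definition Sigma_left ::
    "real \<Rightarrow> real^'q::finite^'q \<Rightarrow> real^'q^'q \<Rightarrow> real \<Rightarrow> real^'q^'q" where
  "Sigma_left \<theta> \<Sigma>\<^sub>l \<Sigma>\<^sub>r \<nu> =
     (if \<nu> \<le> \<theta> then \<Sigma>\<^sub>l else (\<theta> / \<nu>) *\<^sub>R \<Sigma>\<^sub>l + ((\<nu> - \<theta>) / \<nu>) *\<^sub>R \<Sigma>\<^sub>r)"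

definition Sigma_right ::
    "real \<Rightarrow> real^'q::finite^'q \<Rightarrow> real^'q^'q \<Rightarrow> real \<Rightarrow> real^'q^'q" where
  "Sigma_right \<theta> \<Sigma>\<^sub>l \<Sigma>\<^sub>r \<nu> =
     (if \<nu> < \<theta> then ((\<theta> - \<nu>) / (1 - \<nu>)) *\<^sub>R \<Sigma>\<^sub>l + ((1 - \<theta>) / (1 - \<nu>)) *\<^sub>R \<Sigma>\<^sub>r
      else \<Sigma>\<^sub>r)"

text \<open>
  The limiting objective is real valued: if \<open>\<epsilon> > 0\<close>, or if both limit matrices are positive
  definite, the determinants are positive. The values at \<open>0\<close> and \<open>1\<close> are one-sided limits.
\<close>

definition J_inf_inner ::
    "real \<Rightarrow> real \<Rightarrow> real^'q::finite^'q \<Rightarrow> real^'q^'q \<Rightarrow> real \<Rightarrow> real" where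
  "J_inf_inner \<theta> \<epsilon> \<Sigma>\<^sub>l \<Sigma>\<^sub>r \<nu> =
     \<nu> * ln (det (Sigma_left \<theta> \<Sigma>\<^sub>l \<Sigma>\<^sub>r \<nu> + \<epsilon> *\<^sub>R mat 1))
     + (1 - \<nu>) * ln (det (Sigma_right \<theta> \<Sigma>\<^sub>l \<Sigma>\<^sub>r \<nu> + \<epsilon> *\<^sub>R mat 1))"

definition J_inf ::
    "real \<Rightarrow> real \<Rightarrow> real^'q::finite^'q \<Rightarrow> real^'q^'q \<Rightarrow> real \<Rightarrow> real" where
  "J_inf \<theta> \<epsilon> \<Sigma>\<^sub>l \<Sigma>\<^sub>r \<nu> =
     (if \<nu> = 0 then Lim (at_right 0) (J_inf_inner \<theta> \<epsilon> \<Sigma>\<^sub>l \<Sigma>\<^sub>r)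
      else if \<nu> = 1 then Lim (at_left 1) (J_inf_inner \<theta> \<epsilon> \<Sigma>\<^sub>l \<Sigma>\<^sub>r)
      else J_inf_inner \<theta> \<epsilon> \<Sigma>\<^sub>l \<Sigma>\<^sub>r \<nu>)"

definition strictly_concave_on :: "real set \<Rightarrow> (real \<Rightarrow> real) \<Rightarrow> bool" where
  "strictly_concave_on S f \<longleftrightarrow> convex S \<and>
     (\<forall>x\<in>S. \<forall>y\<in>S. \<forall>t. x \<noteq> y \<and> 0 < t \<and> t < 1 \<longrightarrow>
        (1 - t) * f x + t * f y < f ((1 - t) * x + t * y))"

end

theory Submission
  imports Defs
begin

text \<open>
  Write \<open>A = \<Sigma>\<^sub>l + \<epsilon> I\<close> and \<open>B = \<Sigma>\<^sub>r + \<epsilon> I\<close>. For \<open>\<nu> \<le> \<theta>\<close> the excess of the limiting objective over its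
  value at \<open>\<theta>\<close> is \<open>1 - \<nu>\<close> times the concavity gap of \<open>ln det\<close> between \<open>A\<close> and \<open>B\<close>; the case
  \<open>\<nu> \<ge> \<theta>\<close> is its mirror image under \<open>\<nu> \<mapsto> 1 - \<nu>\<close>. Diagonalizing \<open>A\<close> and \<open>B\<close> simultaneously as
  quadratic forms, \<open>ln det\<close> becomes a sum of scalar logarithms along the segment, and its second
  derivative is at most \<open>- \<parallel>B - A\<parallel>\<^sup>2 / K\<^sup>2\<close> in Frobenius norm when all forms are bounded by \<open>K\<close>.
  This yields the cusp with the stated constant.

  The empirical partial second moments have nondecreasing trace and positive semidefinite increments,
  so their pointwise convergence is uniform. Away from the endpoints \<open>ln det\<close> is uniformly continuous near
  the segment from \<open>A\<close> to \<open>B\<close>; near them the weight \<open>\<nu>\<close> beats the logarithmic growth of \<open>ln det\<close> when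
  \<open>\<epsilon> > 0\<close>. Uniform convergence and the cusp give consistency.
\<close>

section \<open>Simultaneous diagonalization of quadratic forms\<close>

text \<open>The diagonalizing matrix \<open>V\<close> is not orthogonal, so the scalars along the
  segment do not show the Frobenius norm directly. The sum of the squares of their logarithmic
  derivatives is the squared Frobenius norm of X^(-1/2) (B - A) X^(-1/2) at the current point X, and
  undoing this congruence costs the factor K^2; with K = M + \<epsilon> this is the denominator of
  the cusp constant, and its 2 is that of a second-order Taylor term. For \<nu> < \<theta> let w be
  the share of the right block that lies after \<theta>. Then (1 - \<nu>) w = 1 - \<theta> does not
  depend on \<nu>, which makes the gap linear in \<theta> - \<nu> and puts 1 - \<theta> into the
  constant. Block averages themselves need not converge uniformly, since a short block at an
  endpoint averages few observations. What converges uniformly is the average times its relative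
  length, and the objective puts that same length in front of the logarithm. For \<epsilon> = 0
  trimming bounds the length from below instead, and m > 0 makes both limits positive definite, so
  that A and B are positive definite in either case.\<close>

definition pos_def :: "real^'q::finite^'q \<Rightarrow> bool" where
  "pos_def A \<longleftrightarrow> transpose A = A \<and> (\<forall>x. x \<noteq> 0 \<longrightarrow> 0 < x \<bullet> (A *v x))"

definition diag :: "('q::finite \<Rightarrow> real) \<Rightarrow> real^'q^'q" where
  "diag d = (\<chi> i j. if i = j then d i else 0)"

lemma inner_symmetric_matrix:
  fixes A :: "real^'q::finite^'q"
  assumes "transpose A = A"
  shows "x \<bullet> (A *v y) = y \<bullet> (A *v x)"
  by (metis assms dot_lmul_matrix inner_commute transpose_matrix_vector)

text \<open>At p + t x the form equals 2 t b + t^2 c, since its constant term vanishes; a nonzero b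
  would make this negative for small t of the opposite sign. This first-order condition turns a
  maximal Rayleigh quotient into an eigenvector equation without derivatives.\<close>

lemma psd_form_zero:
  fixes N :: "real^'q::finite^'q"
  assumes sym: "transpose N = N" and "subspace S"
    and nn: "\<And>x. x \<in> S \<Longrightarrow> 0 \<le> x \<bullet> (N *v x)"
    and p: "p \<in> S" "p \<bullet> (N *v p) = 0" and x: "x \<in> S"
  shows "x \<bullet> (N *v p) = 0"
proof (rule ccontr)
  define b c where "b = x \<bullet> (N *v p)" and "c = x \<bullet> (N *v x)"
  assume "x \<bullet> (N *v p) \<noteq> 0"
  hence b: "b \<noteq> 0" by (simp add: b_def)
  have c: "0 \<le> c" using nn[OF x] by (simp add: c_def)
  have q: "0 \<le> 2 * t * b + t\<^sup>2 * c" for t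
  proof -
    have "p + t *\<^sub>R x \<in> S" using assms by (simp add: subspace_add subspace_scale)
    from nn[OF this] show ?thesis
      using inner_symmetric_matrix[OF sym, of p x] p
      by (simp add: matrix_vector_right_distrib matrix_vector_mult_scaleR inner_add_left
          inner_add_right b_def c_def power2_eq_square algebra_simps)
  qed
  \<comment> \<open>The optimal step would be - b / c; with c + 1 in place of c it exists for c = 0
    too and still makes the value negative.\<close>
  define u where "u = 1 / (c + 1)"
  have u: "u > 0" "u * c = 1 - u" using c by (auto simp: u_def field_simps)
  have "0 \<le> 2 * (- b * u) * b + (- b * u)\<^sup>2 * c" by (rule q)
  also have "\<dots> = b\<^sup>2 * u * (u * c - 2)" by (simp add: power2_eq_square algebra_simps)
  also have "\<dots> = b\<^sup>2 * u * ((1 - u) - 2)" by (simp only: u(2))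
  also have "\<dots> = - (b\<^sup>2 * u * (1 + u))" by (simp add: algebra_simps)
  finally show False using b u(1) by (smt (verit) mult_pos_pos zero_less_power2)
qed

text \<open>The quotient of the two forms is invariant under scaling, so its maximum over
  \<open>S\<close> is attained on the compact unit sphere of \<open>S\<close>. The eigenvector
  equation is tested only against \<open>S\<close>, because \<open>A\<close> need not respect
  \<open>S\<close>; this is all that the induction on the dimension needs.\<close>

lemma generalized_rayleigh_max:
  fixes X A :: "real^'q::finite^'q"
  assumes X: "pos_def X" and A: "transpose A = A" and S: "subspace S" "S \<noteq> {0}"
  obtains p l where "p \<in> S" "p \<bullet> (X *v p) = 1"
    "\<And>x. x \<in> S \<Longrightarrow> x \<bullet> (A *v x) \<le> l * (x \<bullet> (X *v x))"
    "\<And>x. x \<in> S \<Longrightarrow> x \<bullet> (A *v p) = l * (x \<bullet> (X *v p))"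
proof -
  define C where "C = sphere 0 1 \<inter> S"
  have Xpos: "0 < x \<bullet> (X *v x)" if "x \<noteq> 0" for x using X that by (simp add: pos_def_def)
  have Xsym: "transpose X = X" using X by (simp add: pos_def_def)
  obtain s where s: "s \<in> S" "s \<noteq> 0" using S subspace_0 by blast
  have nz: "x \<noteq> 0" if "x \<in> C" for x using that by (auto simp: C_def)
  have "compact C" unfolding C_def using S by (intro compact_Int_closed) (auto simp: closed_subspace)
  moreover have "C \<noteq> {}"
  proof -
    have "(1 / norm s) *\<^sub>R s \<in> C" using s S by (simp add: C_def subspace_scale)
    thus ?thesis by blast
  qed
  moreover have "continuous_on C (\<lambda>x. (x \<bullet> (A *v x)) / (x \<bullet> (X *v x)))"
  proof -
    have c: "continuous_on C (\<lambda>x. x \<bullet> (Y *v x))" for Y :: "real^'q^'q"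
      by (rule continuous_on_inner[OF continuous_on_id linear_continuous_on[OF matrix_vector_mul_bounded_linear]])
    have "\<forall>x\<in>C. x \<bullet> (X *v x) \<noteq> 0" using Xpos[OF nz] by (metis less_irrefl)
    thus ?thesis by (rule continuous_on_divide[OF c c])
  qed
  ultimately obtain p0 where p0: "p0 \<in> C"
    "\<And>x. x \<in> C \<Longrightarrow> (x \<bullet> (A *v x)) / (x \<bullet> (X *v x)) \<le> (p0 \<bullet> (A *v p0)) / (p0 \<bullet> (X *v p0))"
    using continuous_attains_sup[of C "\<lambda>x. (x \<bullet> (A *v x)) / (x \<bullet> (X *v x))"] by blast
  define l where "l = (p0 \<bullet> (A *v p0)) / (p0 \<bullet> (X *v p0))"
  have le: "x \<bullet> (A *v x) \<le> l * (x \<bullet> (X *v x))" if x: "x \<in> S" for x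
  proof (cases "x = 0")
    case False
    define u where "u = (1 / norm x) *\<^sub>R x"
    have "u \<in> C" using x False S by (simp add: C_def u_def subspace_scale)
    hence "u \<bullet> (A *v u) \<le> l * (u \<bullet> (X *v u))"
      using p0(2)[of u] Xpos[OF nz] by (simp add: l_def field_simps)
    hence "(1 / norm x)\<^sup>2 * (x \<bullet> (A *v x)) \<le> (1 / norm x)\<^sup>2 * (l * (x \<bullet> (X *v x)))"
      by (simp add: u_def matrix_vector_mult_scaleR power2_eq_square field_simps)
    thus ?thesis using False by (simp add: mult_le_cancel_left)
  qed simp
  define r where "r = sqrt (p0 \<bullet> (X *v p0))"
  have p0p: "0 < p0 \<bullet> (X *v p0)" using Xpos nz p0(1) by blast
  hence r: "r > 0" "r * r = p0 \<bullet> (X *v p0)" by (auto simp: r_def)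
  define p where "p = (1 / r) *\<^sub>R p0"
  have pS: "p \<in> S" using p0(1) S by (simp add: p_def C_def subspace_scale)
  have p1: "p \<bullet> (X *v p) = 1"
  proof -
    have "p \<bullet> (X *v p) = (1 / r) * (1 / r) * (r * r)"
      by (simp add: p_def matrix_vector_mult_scaleR r(2))
    thus ?thesis using r(1) by simp
  qed
  \<comment> \<open>The form of l X - A is nonnegative on \<open>S\<close> because l is the maximal
    quotient, and it vanishes at p, where the maximum is attained; \<open>psd_form_zero\<close>
    applies.\<close>
  define N where "N = l *\<^sub>R X - A"
  have Nv: "N *v x = l *\<^sub>R (X *v x) - A *v x" for x
    by (simp add: N_def matrix_vector_mult_diff_rdistrib scaleR_matrix_vector_assoc)
  have Nsym: "transpose N = N" using A Xsym by (simp add: N_def transpose_def vec_eq_iff)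
  have "p0 \<bullet> (N *v p0) = 0" using p0p by (simp add: Nv inner_diff_right l_def)
  hence pN: "p \<bullet> (N *v p) = 0" by (simp add: p_def matrix_vector_mult_scaleR)
  have "x \<bullet> (N *v p) = 0" if "x \<in> S" for x
    using psd_form_zero[OF Nsym S(1) _ pS pN that] le by (simp add: Nv inner_diff_right)
  hence "x \<bullet> (A *v p) = l * (x \<bullet> (X *v p))" if "x \<in> S" for x
    using that by (fastforce simp: Nv inner_diff_right)
  with that[OF pS p1 le] show ?thesis by blast
qed

text \<open>Induction on the dimension: a maximizer p of the quotient is split off, and the
  complement of p in \<open>S\<close> is taken with respect to the form of \<open>X\<close>. On that
  complement the eigenvector equation makes the mixed terms with \<open>A\<close> vanish as well, so
  both forms become diagonal at once.\<close>

lemma simultaneous_orthogonal_basis: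
  fixes X A :: "real^'q::finite^'q"
  assumes X: "pos_def X" and A: "transpose A = A" and "subspace S"
  shows "\<exists>B. finite B \<and> card B = dim S \<and> B \<subseteq> S \<and> (\<forall>u\<in>B. u \<bullet> (X *v u) = 1) \<and>
     (\<forall>u\<in>B. \<forall>v\<in>B. u \<noteq> v \<longrightarrow> u \<bullet> (X *v v) = 0 \<and> u \<bullet> (A *v v) = 0)"
  using \<open>subspace S\<close>
proof (induction "dim S" arbitrary: S)
  case 0
  thus ?case by (intro exI[of _ "{}"]) auto
next
  case (Suc n)
  have Xsym: "transpose X = X" using X by (simp add: pos_def_def)
  have "S \<noteq> {0}" using Suc.hyps(2) by auto
  then obtain p l where p: "p \<in> S" "p \<bullet> (X *v p) = 1"
    and orth: "\<And>x. x \<in> S \<Longrightarrow> x \<bullet> (A *v p) = l * (x \<bullet> (X *v p))"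
    using generalized_rayleigh_max[OF X A Suc.prems] by metis
  define S' where "S' = {x \<in> S. x \<bullet> (X *v p) = 0}"
  have S': "subspace S'" using Suc.prems
    by (auto simp: S'_def subspace_def inner_add_left)
  have "p \<notin> span S'" using S' p by (simp add: span_eq_iff[THEN iffD2] S'_def)
  moreover have "span (insert p S') = S"
  proof
    show "span (insert p S') \<subseteq> S"
      using p Suc.prems by (intro span_minimal) (auto simp: S'_def)
    show "S \<subseteq> span (insert p S')"
    proof
      fix x assume x: "x \<in> S"
      define y where "y = x - (x \<bullet> (X *v p)) *\<^sub>R p"
      have "y \<in> S'" using x p Suc.prems
        by (simp add: y_def S'_def subspace_diff subspace_scale inner_diff_left)
      hence "(x \<bullet> (X *v p)) *\<^sub>R p + y \<in> span (insert p S')"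
        by (intro span_add span_scale) (auto intro: span_base)
      thus "x \<in> span (insert p S')" by (simp add: y_def)
    qed
  qed
  ultimately have "dim S = dim S' + 1" using dim_insert[of p S'] by (metis dim_span)
  hence "n = dim S'" using Suc.hyps(2) by simp
  from Suc.hyps(1)[OF this S'] obtain B where B: "finite B" "card B = dim S'" "B \<subseteq> S'"
    "\<forall>u\<in>B. u \<bullet> (X *v u) = 1"
    "\<forall>u\<in>B. \<forall>v\<in>B. u \<noteq> v \<longrightarrow> u \<bullet> (X *v v) = 0 \<and> u \<bullet> (A *v v) = 0" by blast
  have pB: "p \<notin> B" using B(3) p by (auto simp: S'_def)
  have pu: "u \<bullet> (X *v p) = 0 \<and> u \<bullet> (A *v p) = 0 \<and> p \<bullet> (X *v u) = 0 \<and> p \<bullet> (A *v u) = 0"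
    if "u \<in> B" for u
  proof -
    have "u \<in> S'" using that B by blast
    thus ?thesis using orth[of u] inner_symmetric_matrix[OF Xsym, of p u]
      inner_symmetric_matrix[OF A, of p u] by (simp add: S'_def)
  qed
  show ?case
  proof (intro exI[of _ "insert p B"] conjI)
    show "card (insert p B) = dim S" using B pB \<open>dim S = dim S' + 1\<close> by simp
    show "insert p B \<subseteq> S" using B p by (auto simp: S'_def)
  qed (use B p pu in auto)
qed

lemma matrix_mult_entry:
  fixes P Y :: "real^'q::finite^'q"
  shows "(transpose P ** Y ** P) $ i $ j = column i P \<bullet> (Y *v column j P)"
proof -
  have "column i P \<bullet> (Y *v column j P) = (\<Sum>k\<in>UNIV. \<Sum>n\<in>UNIV. P $ k $ i * (Y $ k $ n * P $ n $ j))"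
    by (simp add: column_def inner_vec_def matrix_vector_mult_def sum_distrib_left)
  also have "\<dots> = (\<Sum>n\<in>UNIV. \<Sum>k\<in>UNIV. P $ k $ i * (Y $ k $ n * P $ n $ j))"
    by (rule sum.swap)
  also have "\<dots> = (transpose P ** Y ** P) $ i $ j"
    by (simp add: matrix_matrix_mult_def transpose_def sum_distrib_right mult.assoc)
  finally show ?thesis by simp
qed

text \<open>With the common orthogonal basis as the columns of \<open>P\<close>, congruence by
  \<open>P\<close> sends \<open>X\<close> to the identity and \<open>A\<close> to a diagonal matrix;
  \<open>V\<close> is the inverse of \<open>P\<close>.\<close>

lemma simultaneous_diagonalization:
  fixes X A :: "real^'q::finite^'q"
  assumes X: "pos_def X" and A: "transpose A = A"
  obtains V d where "det V \<noteq> 0" "X = transpose V ** V" "A = transpose V ** diag d ** V"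
proof -
  obtain B where B: "finite B" "card B = CARD('q)"
    "\<forall>u\<in>B. u \<bullet> (X *v u) = 1"
    "\<forall>u\<in>B. \<forall>v\<in>B. u \<noteq> v \<longrightarrow> u \<bullet> (X *v v) = 0 \<and> u \<bullet> (A *v v) = 0"
    using simultaneous_orthogonal_basis[OF assms subspace_UNIV] by auto
  obtain f :: "'q \<Rightarrow> real^'q" where f: "bij_betw f UNIV B"
    using B finite_same_card_bij[of "UNIV::'q set" B] by auto
  define P :: "real^'q^'q" where "P = (\<chi> i j. f j $ i)"
  define d where "d i = f i \<bullet> (A *v f i)" for i
  have col: "column i P = f i" for i by (simp add: column_def P_def vec_eq_iff)
  have fB: "f i \<in> B" for i using f by (auto simp: bij_betw_def)
  have inj: "f i = f j \<longleftrightarrow> i = j" for i j using f by (auto simp: bij_betw_def inj_on_def)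
  have PX: "transpose P ** X ** P = mat 1"
    unfolding vec_eq_iff matrix_mult_entry col mat_def using B fB inj by auto
  have PA: "transpose P ** A ** P = diag d"
    unfolding vec_eq_iff matrix_mult_entry col diag_def using B fB inj
    by (auto simp: d_def)
  have "det P \<noteq> 0" using arg_cong[OF PX, of det] by (auto simp: det_mul)
  then obtain V where V: "P ** V = mat 1" "V ** P = mat 1"
    by (auto simp: invertible_def simp flip: invertible_det_nz)
  have VT: "transpose V ** transpose P = mat 1"
    using V(1) by (metis matrix_transpose_mul transpose_mat)
  have pull: "Y = transpose V ** (transpose P ** Y ** P) ** V" for Y
    by (metis V(1) VT matrix_mul_assoc matrix_mul_lid matrix_mul_rid)
  have "det V \<noteq> 0" using arg_cong[OF V(1), of det] by (auto simp: det_mul)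
  moreover have "X = transpose V ** V" using pull[of X] PX by simp
  moreover have "A = transpose V ** diag d ** V" using pull[of A] PA by simp
  ultimately show ?thesis using that by blast
qed

lemma det_diag: "det (diag d) = (\<Prod>i\<in>UNIV. d i)"
  using det_diagonal[of "diag d"] by (simp add: diag_def)

lemma inner_gram:
  fixes V :: "real^'q::finite^'q"
  shows "x \<bullet> (transpose V ** V *v x) = (norm (V *v x))\<^sup>2"
  by (metis (no_types, lifting) dot_lmul_matrix dot_square_norm inner_commute matrix_vector_mul_assoc
      transpose_matrix_vector)

section \<open>The Frobenius norm under congruence\<close>

lemma norm_transpose: "norm (transpose A) = norm (A :: real^'q::finite^'q)"
proof -
  have "(\<Sum>i\<in>UNIV. \<Sum>j\<in>UNIV. (A $ j $ i)\<^sup>2) = (\<Sum>i\<in>UNIV. \<Sum>j\<in>UNIV. (A $ i $ j)\<^sup>2)"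
    by (rule sum.swap)
  thus ?thesis by (simp add: norm_eq_frobenius transpose_def)
qed

lemma norm_sq_columns:
  fixes A :: "real^'q::finite^'q"
  shows "(norm A)\<^sup>2 = (\<Sum>j\<in>UNIV. (norm (A *v axis j 1))\<^sup>2)"
proof -
  have "(norm A)\<^sup>2 = (\<Sum>i\<in>UNIV. \<Sum>j\<in>UNIV. (A $ i $ j)\<^sup>2)"
    by (simp add: norm_eq_frobenius sum_nonneg)
  also have "\<dots> = (\<Sum>j\<in>UNIV. \<Sum>i\<in>UNIV. (A $ i $ j)\<^sup>2)" by (rule sum.swap)
  also have "\<dots> = (\<Sum>j\<in>UNIV. (norm (A *v axis j 1))\<^sup>2)"
    by (simp add: matrix_vector_mult_basis norm_vec_def L2_set_def sum_nonneg column_def)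
  finally show ?thesis .
qed

text \<open>The assumption bounds the squared operator norm of \<open>V\<close> by \<open>K\<close>,
  and the transpose inherits the bound. Multiplication by the transpose from the left acts column by
  column, which costs one factor \<open>K\<close>; the right factor \<open>V\<close> is moved to the
  left by transposing the product and costs the second.\<close>

lemma frobenius_congruence_le:
  fixes V F :: "real^'q::finite^'q"
  assumes V: "\<And>x. (norm (V *v x))\<^sup>2 \<le> K * (norm x)\<^sup>2" and K: "0 \<le> K"
  shows "(norm (transpose V ** F ** V))\<^sup>2 \<le> K\<^sup>2 * (norm F)\<^sup>2"
proof -
  have VT: "(norm (transpose V *v w))\<^sup>2 \<le> K * (norm w)\<^sup>2" for w
  proof -
    let ?z = "transpose V *v w"
    have "(norm ?z)\<^sup>2 = w \<bullet> (V *v ?z)"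
      by (metis dot_lmul_matrix dot_square_norm transpose_matrix_vector)
    also have "\<dots> \<le> norm w * norm (V *v ?z)" by (rule norm_cauchy_schwarz)
    finally have "((norm ?z)\<^sup>2)\<^sup>2 \<le> (norm w * norm (V *v ?z))\<^sup>2" by (intro power_mono) auto
    also have "\<dots> \<le> (norm w)\<^sup>2 * (K * (norm ?z)\<^sup>2)"
      using V[of ?z] by (simp add: power_mult_distrib mult_left_mono)
    finally have *: "(norm ?z)\<^sup>2 * (norm ?z)\<^sup>2 \<le> (norm ?z)\<^sup>2 * (K * (norm w)\<^sup>2)"
      by (simp add: power2_eq_square algebra_simps)
    show ?thesis
    proof (cases "?z = 0")
      case True
      thus ?thesis using K by (simp del: transpose_matrix_vector)
    next
      case False
      hence "0 < (norm ?z)\<^sup>2" by (simp del: transpose_matrix_vector)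
      with * show ?thesis by (meson mult_le_cancel_left_pos)
    qed
  qed
  have left: "(norm (transpose V ** G))\<^sup>2 \<le> K * (norm G)\<^sup>2" for G :: "real^'q^'q"
    unfolding norm_sq_columns sum_distrib_left
    by (intro sum_mono) (use VT in \<open>simp add: matrix_vector_mul_assoc[symmetric] del: transpose_matrix_vector\<close>)
  have "(norm (transpose V ** F ** V))\<^sup>2 \<le> K * (norm (F ** V))\<^sup>2"
    using left[of "F ** V"] by (simp add: matrix_mul_assoc)
  also have "norm (F ** V) = norm (transpose V ** transpose F)"
    by (metis matrix_transpose_mul norm_transpose)
  also have "K * \<dots>\<^sup>2 \<le> K * (K * (norm F)\<^sup>2)"
    using left[of "transpose F"] K by (simp add: norm_transpose mult_left_mono)
  finally show ?thesis by (simp add: power2_eq_square algebra_simps)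
qed

lemma norm_diag: "(norm (diag d))\<^sup>2 = (\<Sum>i\<in>UNIV. (d i)\<^sup>2)"
proof -
  have "(\<Sum>j\<in>UNIV. (if i = j then d i else 0)\<^sup>2) = (d i)\<^sup>2" for i
    by (simp add: if_distrib[of "\<lambda>x. x\<^sup>2"] cong: if_cong)
  thus ?thesis by (simp add: norm_eq_frobenius diag_def sum_nonneg)
qed

lemma diag_mult: "diag a ** diag b = diag (\<lambda>i. a i * b i)"
  by (simp add: diag_def matrix_matrix_mult_def vec_eq_iff if_distrib[of "\<lambda>x. x * _"] cong: if_cong)

lemma transpose_diag: "transpose (diag d) = diag d"
  by (auto simp: diag_def transpose_def vec_eq_iff)

lemma matrix_mult_add_rdistrib:
  fixes A B C :: "real^'q::finite^'q"
  shows "(A + B) ** C = A ** C + B ** C"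
  by (simp add: matrix_matrix_mult_def vec_eq_iff distrib_right sum.distrib)

lemma congruence_combine:
  fixes V :: "real^'q::finite^'q"
  shows "s *\<^sub>R (transpose V ** diag a ** V) + t *\<^sub>R (transpose V ** diag b ** V) =
    transpose V ** diag (\<lambda>i. s * a i + t * b i) ** V"
proof -
  have "diag (\<lambda>i. s * a i + t * b i) = s *\<^sub>R diag a + t *\<^sub>R diag b"
    by (auto simp: diag_def vec_eq_iff)
  thus ?thesis
    by (simp only: matrix_add_ldistrib matrix_mult_add_rdistrib matrix_scalar_ac scalar_matrix_assoc[symmetric])
qed

section \<open>Strong concavity of the log-determinant\<close>

lemma inner_congruence:
  fixes V F :: "real^'q::finite^'q"
  shows "x \<bullet> (transpose V ** F ** V *v x) = (V *v x) \<bullet> (F *v (V *v x))"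
  by (metis dot_lmul_matrix matrix_vector_mul_assoc vector_transpose_matrix)

lemma inner_diag_axis: "axis i 1 \<bullet> (diag d *v axis i 1) = d i"
  by (simp add: inner_axis' matrix_vector_mult_basis column_def diag_def)

lemma det_nonzero_surj:
  fixes V :: "real^'q::finite^'q"
  assumes "det V \<noteq> 0"
  obtains x where "V *v x = z"
proof -
  obtain W where "V ** W = mat 1" using assms by (auto simp: invertible_def simp flip: invertible_det_nz)
  hence "V *v (W *v z) = z" by (simp add: matrix_vector_mul_assoc)
  thus ?thesis by (rule that)
qed

lemma norm_matrix_vector_le:
  fixes A :: "real^'n::finite^'m::finite"
  shows "norm (A *v x) \<le> norm A * norm x"
proof -
  have "(norm (A *v x))\<^sup>2 = (\<Sum>i\<in>UNIV. (A $ i \<bullet> x)\<^sup>2)"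
    by (simp add: norm_vec_def L2_set_def sum_nonneg matrix_vector_mul_component)
  also have "\<dots> \<le> (\<Sum>i\<in>UNIV. (norm (A $ i))\<^sup>2 * (norm x)\<^sup>2)"
    by (intro sum_mono) (metis Cauchy_Schwarz_ineq power2_norm_eq_inner)
  also have "\<dots> = (norm A * norm x)\<^sup>2"
    by (simp add: norm_vec_def[of A] L2_set_def sum_nonneg power_mult_distrib sum_distrib_right)
  finally show ?thesis by (rule power2_le_imp_le) simp
qed

lemma quadratic_form_le_norm:
  fixes A :: "real^'q::finite^'q"
  shows "x \<bullet> (A *v x) \<le> norm A * (norm x)\<^sup>2"
proof -
  have "x \<bullet> (A *v x) \<le> norm x * norm (A *v x)" by (rule norm_cauchy_schwarz)
  also have "\<dots> \<le> norm x * (norm A * norm x)" by (intro mult_left_mono norm_matrix_vector_le) simp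
  finally show ?thesis by (simp add: power2_eq_square algebra_simps)
qed

lemma op_norm_le_norm: "op_norm A \<le> norm A"
  unfolding op_norm_def by (intro onorm_le norm_matrix_vector_le)

lemma quadratic_form_le_op_norm:
  fixes A :: "real^'q::finite^'q"
  shows "x \<bullet> (A *v x) \<le> op_norm A * (norm x)\<^sup>2"
proof -
  have "x \<bullet> (A *v x) \<le> norm x * norm (A *v x)" by (rule norm_cauchy_schwarz)
  also have "\<dots> \<le> norm x * (op_norm A * norm x)"
    unfolding op_norm_def by (intro mult_left_mono onorm matrix_vector_mul_bounded_linear) simp
  finally show ?thesis by (simp add: power2_eq_square algebra_simps)
qed

lemma op_norm_diff_le:
  fixes A B :: "real^'q::finite^'q"
  shows "\<bar>op_norm A - op_norm B\<bar> \<le> norm (A - B)"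
proof -
  have le: "op_norm A \<le> op_norm B + norm (A - B)" for A B :: "real^'q^'q"
  proof -
    have "op_norm A = onorm (\<lambda>x. B *v x + (A - B) *v x)"
      by (simp add: op_norm_def flip: matrix_vector_mult_add_rdistrib)
    also have "\<dots> \<le> op_norm B + op_norm (A - B)"
      unfolding op_norm_def by (intro onorm_triangle matrix_vector_mul_bounded_linear)
    finally show ?thesis using op_norm_le_norm[of "A - B"] by linarith
  qed
  from le[of A B] le[of B A] show ?thesis by (simp add: norm_minus_commute abs_le_iff)
qed

lemma tendsto_op_norm:
  fixes A :: "real^'q::finite^'q"
  assumes "(f \<longlongrightarrow> A) F"
  shows "((\<lambda>n. op_norm (f n)) \<longlongrightarrow> op_norm A) F"
proof (rule LIM_zero_cancel, rule tendsto_0_le)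
  show "((\<lambda>n. f n - A) \<longlongrightarrow> 0) F" using assms by (rule LIM_zero)
  show "\<forall>\<^sub>F n in F. norm (op_norm (f n) - op_norm A) \<le> norm (f n - A) * 1"
    by (simp add: op_norm_diff_le)
qed

text \<open>Diagonalizing \<open>A\<close> against itself writes it as
  \<open>transpose V ** V\<close>, so the determinant is the square of \<open>det V\<close>.\<close>

lemma pos_def_det_pos: "pos_def A \<Longrightarrow> 0 < det A"
  by (rule simultaneous_diagonalization[of A A]) (auto simp: det_mul pos_def_def not_square_less_zero
      simp flip: power2_eq_square)

lemma pos_def_combine:
  assumes "pos_def A" "pos_def B" "0 \<le> t" "t \<le> 1"
  shows "pos_def ((1 - t) *\<^sub>R A + t *\<^sub>R B)"
proof -
  have "0 < (1 - t) * (x \<bullet> (A *v x)) + t * (x \<bullet> (B *v x))" if "x \<noteq> 0" for x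
  proof (cases "t = 1")
    case False
    thus ?thesis using assms that by (intro add_pos_nonneg) (auto simp: pos_def_def less_imp_le)
  qed (use assms that in \<open>auto simp: pos_def_def\<close>)
  thus ?thesis using assms
    by (auto simp: pos_def_def matrix_vector_mult_add_rdistrib inner_add_right transpose_def vec_eq_iff
        simp flip: scaleR_matrix_vector_assoc)
qed

lemma psd_add_scaled_id_pos_def:
  assumes "psd A" "0 < \<epsilon>"
  shows "pos_def (A + \<epsilon> *\<^sub>R mat 1)"
proof -
  have "0 < x \<bullet> (A *v x) + \<epsilon> * (x \<bullet> x)" if "x \<noteq> 0" for x
    using assms that by (intro add_nonneg_pos) (auto simp: psd_def)
  moreover have "transpose (A + \<epsilon> *\<^sub>R mat 1) = A + \<epsilon> *\<^sub>R mat 1"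
    using assms(1) by (auto simp: psd_def transpose_def vec_eq_iff mat_def)
  ultimately show ?thesis
    by (simp add: pos_def_def matrix_vector_mult_add_rdistrib inner_add_right
        flip: scaleR_matrix_vector_assoc)
qed

text \<open>Along the segment ln det is a constant plus the sum of ln (1 + s h_i), with second
  derivative minus the sum of (h_i / e_i)^2. A curvature bound by \<open>c\<close> means that
  subtracting the parabola c s^2 / 2 from the negated function leaves it convex; the chord
  inequality between 0 and 1 then produces the term c t (1 - t) / 2.\<close>

lemma ln_det_strongly_concave:
  fixes A B :: "real^'q::finite^'q"
  assumes A: "pos_def A" and B: "pos_def B" and K: "0 < K"
    and AK: "\<And>x. x \<bullet> (A *v x) \<le> K * (norm x)\<^sup>2"
    and BK: "\<And>x. x \<bullet> (B *v x) \<le> K * (norm x)\<^sup>2"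
    and t: "0 \<le> t" "t \<le> 1"
  shows "(1 - t) * ln (det A) + t * ln (det B) + t * (1 - t) / (2 * K\<^sup>2) * (norm (B - A))\<^sup>2
         \<le> ln (det ((1 - t) *\<^sub>R A + t *\<^sub>R B))"
proof -
  have Bsym: "transpose B = B" using B by (simp add: pos_def_def)
  obtain V d where V: "det V \<noteq> 0" and AV: "A = transpose V ** V" and BV: "B = transpose V ** diag d ** V"
    using simultaneous_diagonalization[OF A Bsym] by blast
  have d: "0 < d i" for i
  proof -
    obtain x where x: "V *v x = axis i 1" using det_nonzero_surj[OF V] .
    hence "x \<noteq> 0" by (auto simp: axis_eq_0_iff)
    hence "0 < x \<bullet> (B *v x)" using B by (simp add: pos_def_def)
    thus ?thesis by (simp add: BV inner_congruence x inner_diag_axis)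
  qed
  \<comment> \<open>The \<open>d i\<close> are the eigenvalues of \<open>B\<close> relative to
    \<open>A\<close>, so the \<open>e s i\<close> are those of the point with parameter s on the
    segment.\<close>
  define h where "h i = d i - 1" for i
  define e where "e s i = 1 + s * h i" for s i
  define f where "f s = (\<Sum>i\<in>UNIV. ln (e s i))" for s
  define c where "c = (norm (B - A))\<^sup>2 / K\<^sup>2"
  have A1: "A = transpose V ** diag (\<lambda>_. 1) ** V"
    by (simp add: AV diag_def mat_def[symmetric])
  have X: "(1 - s) *\<^sub>R A + s *\<^sub>R B = transpose V ** diag (e s) ** V" for s
    unfolding A1 BV congruence_combine e_def h_def by (simp add: algebra_simps)
  have H: "B - A = transpose V ** diag h ** V"
    using congruence_combine[of "-1" V "\<lambda>_. 1" 1 d] by (simp add: A1[symmetric] BV[symmetric] h_def[abs_def])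
  have e: "0 < e s i" if "0 \<le> s" "s \<le> 1" for s i
  proof -
    have "e s i = (1 - s) * 1 + s * d i" by (simp add: e_def h_def algebra_simps)
    also have "\<dots> > 0" using that d[of i] by (cases "s = 1") (auto intro!: add_pos_nonneg)
    finally show ?thesis .
  qed
  have lndet: "ln (det ((1 - s) *\<^sub>R A + s *\<^sub>R B)) = ln ((det V)\<^sup>2) + f s" if "0 \<le> s" "s \<le> 1" for s
  proof -
    have "det ((1 - s) *\<^sub>R A + s *\<^sub>R B) = (det V)\<^sup>2 * (\<Prod>i\<in>UNIV. e s i)"
      by (simp add: X det_mul det_diag power2_eq_square)
    moreover have "0 < (\<Prod>i\<in>UNIV. e s i)" using e that by (intro prod_pos) auto
    moreover have "ln (\<Prod>i\<in>UNIV. e s i) = f s"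
    proof -
      have "e s i \<noteq> 0" for i using e[OF that, of i] by simp
      thus ?thesis unfolding f_def by (intro ln_prod) simp_all
    qed
    ultimately show ?thesis using V by (simp add: ln_mult_pos)
  qed
  have curvature: "c \<le> (\<Sum>i\<in>UNIV. (h i / e s i)\<^sup>2)" if s: "0 \<le> s" "s \<le> 1" for s
  proof -
    \<comment> \<open>\<open>U\<close> is a square root of the point X on the segment, in the sense
      that transpose U times \<open>U\<close> is X, and its squared operator norm is at most
      \<open>K\<close> because X is a convex combination. Written with \<open>U\<close>, the
      difference B - A is the congruence of the diagonal matrix with entries
      \<open>h i / e s i\<close>, so \<open>frobenius_congruence_le\<close> gives the curvature
      bound.\<close>
    define U where "U = diag (\<lambda>i. sqrt (e s i)) ** V"
    have mid: "transpose U ** diag a ** U = transpose V ** diag (\<lambda>i. e s i * a i) ** V" for a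
    proof -
      have "transpose U ** diag a ** U
          = transpose V ** (diag (\<lambda>i. sqrt (e s i)) ** diag a ** diag (\<lambda>i. sqrt (e s i))) ** V"
        by (simp add: U_def matrix_transpose_mul transpose_diag matrix_mul_assoc)
      also have "diag (\<lambda>i. sqrt (e s i)) ** diag a ** diag (\<lambda>i. sqrt (e s i)) = diag (\<lambda>i. e s i * a i)"
        using e[OF s] by (simp add: diag_mult less_imp_le mult.commute[of _ "a _"] mult.assoc)
      finally show ?thesis .
    qed
    have UU: "transpose U ** U = (1 - s) *\<^sub>R A + s *\<^sub>R B"
      using mid[of "\<lambda>_. 1"] by (simp add: X diag_def mat_def[symmetric])
    have "(norm (U *v x))\<^sup>2 \<le> K * (norm x)\<^sup>2" for x
    proof -
      have "(norm (U *v x))\<^sup>2 = (1 - s) * (x \<bullet> (A *v x)) + s * (x \<bullet> (B *v x))"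
        by (simp add: inner_gram[symmetric] UU matrix_vector_mult_add_rdistrib inner_add_right
            flip: scaleR_matrix_vector_assoc)
      also have "\<dots> \<le> (1 - s) * (K * (norm x)\<^sup>2) + s * (K * (norm x)\<^sup>2)"
        using s AK BK by (intro add_mono mult_left_mono) auto
      finally show ?thesis by (simp add: algebra_simps)
    qed
    from frobenius_congruence_le[OF this, of "diag (\<lambda>i. h i / e s i)"] K
    have "(norm (transpose V ** diag (\<lambda>i. e s i * (h i / e s i)) ** V))\<^sup>2 \<le> K\<^sup>2 * (\<Sum>i\<in>UNIV. (h i / e s i)\<^sup>2)"
      by (simp add: mid norm_diag)
    moreover have "e s i * (h i / e s i) = h i" for i using e[OF s, of i] by simp
    ultimately show ?thesis using K by (simp add: c_def H field_simps)
  qed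
  define g where "g s = - f s - c / 2 * s\<^sup>2" for s
  have "convex_on {0..1} g"
  proof (rule f''_ge0_imp_convex)
    fix s :: real assume s: "s \<in> {0..1}"
    have pos: "0 < e s i" and nz: "e s i \<noteq> 0" for i using e[of s i] s by auto
    show "(g has_real_derivative (- (\<Sum>i\<in>UNIV. h i / e s i) - c * s)) (at s)"
      unfolding g_def f_def e_def
      by (rule derivative_eq_intros refl pos[unfolded e_def] | simp)+
    show "((\<lambda>s. - (\<Sum>i\<in>UNIV. h i / e s i) - c * s) has_real_derivative
        ((\<Sum>i\<in>UNIV. (h i / e s i)\<^sup>2) - c)) (at s)"
      unfolding e_def
      by (rule derivative_eq_intros refl nz[unfolded e_def] | simp add: sum_negf power2_eq_square)+
    show "0 \<le> (\<Sum>i\<in>UNIV. (h i / e s i)\<^sup>2) - c" using curvature[of s] s by simp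
  qed simp
  from convex_onD[OF this t, of 0 1]
  have "g t \<le> (1 - t) * g 0 + t * g 1" by simp
  moreover have f0: "f 0 = 0" by (simp add: f_def e_def)
  ultimately have main: "t * f 1 + c / 2 * (t - t\<^sup>2) \<le> f t" by (simp add: g_def algebra_simps)
  have Q: "t * (1 - t) / (2 * K\<^sup>2) * (norm (B - A))\<^sup>2 = c / 2 * (t - t\<^sup>2)"
    by (simp add: c_def power2_eq_square field_simps)
  have AB: "ln (det A) = ln ((det V)\<^sup>2)" "ln (det B) = ln ((det V)\<^sup>2) + f 1"
    using lndet[of 0] lndet[of 1] f0 by simp_all
  have "(1 - t) * ln ((det V)\<^sup>2) + t * (ln ((det V)\<^sup>2) + f 1) = ln ((det V)\<^sup>2) + t * f 1"
    by (simp add: algebra_simps)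
  with main show ?thesis unfolding AB Q lndet[OF t] by linarith
qed

text \<open>Any common bound of the two forms may serve as \<open>K\<close>, and the sum of the
  norms is one; the quadratic gain is then positive because \<open>A \<noteq> B\<close>.\<close>

lemma ln_det_strictly_concave:
  fixes A B :: "real^'q::finite^'q"
  assumes A: "pos_def A" and B: "pos_def B" and "A \<noteq> B" and t: "0 < t" "t < 1"
  shows "(1 - t) * ln (det A) + t * ln (det B) < ln (det ((1 - t) *\<^sub>R A + t *\<^sub>R B))"
proof -
  define K where "K = norm A + norm B"
  have K: "0 < K" using \<open>A \<noteq> B\<close> by (auto simp: K_def add_nonneg_eq_0_iff less_le)
  have "x \<bullet> (A *v x) \<le> K * (norm x)\<^sup>2" "x \<bullet> (B *v x) \<le> K * (norm x)\<^sup>2" for x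
    using quadratic_form_le_norm[of x A] quadratic_form_le_norm[of x B]
    by (auto simp: K_def distrib_right add_increasing add_increasing2)
  from ln_det_strongly_concave[OF A B K this, of t]
  have "(1 - t) * ln (det A) + t * ln (det B) + t * (1 - t) / (2 * K\<^sup>2) * (norm (B - A))\<^sup>2
         \<le> ln (det ((1 - t) *\<^sub>R A + t *\<^sub>R B))" using t by simp
  moreover have "0 < t * (1 - t) / (2 * K\<^sup>2) * (norm (B - A))\<^sup>2" using t K \<open>A \<noteq> B\<close> by simp
  ultimately show ?thesis by linarith
qed

lemma pos_def_id: "pos_def (mat 1)"
  by (simp add: pos_def_def)

text \<open>A \<open>LEAST\<close> over the reals is informative only once a least eigenvalue is
  known to exist. It is minus the maximal Rayleigh quotient of - A: the maximizer is an eigenvector,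
  and any other eigenvalue is compared by evaluating the quotient at its own eigenvector.\<close>

lemma lambda_min_le_form:
  fixes A :: "real^'q::finite^'q"
  assumes A: "transpose A = A"
  shows "lambda_min A * (norm x)\<^sup>2 \<le> x \<bullet> (A *v x)"
proof -
  have neg: "(- A) *v x = - (A *v x)" for x :: "real^'q"
    using scaleR_matrix_vector_assoc[of "-1" A x] by simp
  have "transpose (- A) = - A" using A by (simp add: transpose_def vec_eq_iff)
  moreover have "(UNIV :: (real^'q) set) \<noteq> {0}" by (metis UNIV_I axis_eq_0_iff singletonD zero_neq_one)
  ultimately obtain p l where p: "p \<bullet> p = 1" and le: "\<And>x. x \<bullet> ((- A) *v x) \<le> l * (x \<bullet> x)"
    and eq: "\<And>x. x \<bullet> ((- A) *v p) = l * (x \<bullet> p)"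
    using generalized_rayleigh_max[OF pos_def_id, of "- A" UNIV] by auto
  have "x \<bullet> (A *v p - (- l) *\<^sub>R p) = 0" for x
    using eq[of x] by (simp add: neg inner_diff_right inner_add_right)
  hence "A *v p = (- l) *\<^sub>R p" by (metis inner_eq_zero_iff right_minus_eq)
  moreover have "p \<noteq> 0" using p by auto
  ultimately have "eigenvalue A (- l)" by (auto simp: eigenvalue_def)
  moreover have "- l \<le> m" if m: "eigenvalue A m" for m
  proof -
    obtain v where v: "v \<noteq> 0" "A *v v = m *\<^sub>R v" using m by (auto simp: eigenvalue_def)
    have "- l * (v \<bullet> v) \<le> m * (v \<bullet> v)" using le[of v] by (simp add: neg v(2))
    thus ?thesis using v(1) by (metis inner_gt_zero_iff mult_le_cancel_right_pos)
  qed
  ultimately have "lambda_min A = - l" unfolding lambda_min_def by (rule Least_equality)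
  thus ?thesis using le[of x] by (simp add: neg power2_norm_eq_inner)
qed

text \<open>Relative to the identity the matrix \<open>V\<close> is orthogonal, so the
  \<open>d i\<close> are ordinary eigenvalues and lie between 0 and \<open>norm W\<close>. The upper
  bound is polynomial in \<open>norm W\<close>, so its logarithm can be beaten by the weight of a
  short block.\<close>

lemma det_psd_add_scaled_id_bounds:
  fixes W :: "real^'q::finite^'q"
  assumes W: "psd W" and \<epsilon>: "0 < \<epsilon>"
  shows "\<epsilon> ^ CARD('q) \<le> det (W + \<epsilon> *\<^sub>R mat 1)"
    and "det (W + \<epsilon> *\<^sub>R mat 1) \<le> (norm W + \<epsilon>) ^ CARD('q)"
proof -
  have "transpose W = W" using W by (simp add: psd_def)
  then obtain V d where V: "det V \<noteq> 0" and 1: "mat 1 = transpose V ** V"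
    and WV: "W = transpose V ** diag d ** V"
    using simultaneous_diagonalization[OF pos_def_id, of W] by blast
  have d: "0 \<le> d i \<and> d i \<le> norm W" for i
  proof -
    obtain x where x: "V *v x = axis i 1" using det_nonzero_surj[OF V] .
    have "(norm x)\<^sup>2 = (norm (V *v x))\<^sup>2"
      using inner_gram[of x V] by (simp add: 1[symmetric] power2_norm_eq_inner)
    moreover have "x \<bullet> (W *v x) = d i" by (simp add: WV inner_congruence x inner_diag_axis)
    ultimately show ?thesis using quadratic_form_le_norm[of x W] W
      by (auto simp: psd_def x norm_axis_1 dest: spec[of _ x])
  qed
  have "mat 1 = transpose V ** diag (\<lambda>_. 1) ** V"
    by (simp only: diag_def mat_def[symmetric] matrix_mul_rid 1[symmetric])
  hence "W + \<epsilon> *\<^sub>R mat 1 = transpose V ** diag (\<lambda>i. d i + \<epsilon>) ** V"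
    using congruence_combine[of 1 V d \<epsilon> "\<lambda>_. 1"] by (simp add: WV)
  moreover have "det V * det V = 1" using arg_cong[OF 1, of det] by (simp add: det_mul)
  ultimately have "det (W + \<epsilon> *\<^sub>R mat 1) = (\<Prod>i\<in>UNIV. d i + \<epsilon>)"
    by (simp add: det_mul det_diag)
  moreover have "(\<Prod>i\<in>(UNIV::'q set). \<epsilon>) \<le> (\<Prod>i\<in>UNIV. d i + \<epsilon>)" using d \<epsilon> by (intro prod_mono) auto
  moreover have "(\<Prod>i\<in>UNIV. d i + \<epsilon>) \<le> (\<Prod>i\<in>(UNIV::'q set). norm W + \<epsilon>)" using d \<epsilon> by (intro prod_mono) auto
  ultimately show "\<epsilon> ^ CARD('q) \<le> det (W + \<epsilon> *\<^sub>R mat 1)"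
    "det (W + \<epsilon> *\<^sub>R mat 1) \<le> (norm W + \<epsilon>) ^ CARD('q)" by simp_all
qed

section \<open>Semidefiniteness and traces of sums of outer squares\<close>

lemma psd_add: "psd A \<Longrightarrow> psd B \<Longrightarrow> psd (A + B)"
  by (auto simp: psd_def transpose_def vec_eq_iff matrix_vector_mult_add_rdistrib inner_add_right)

lemma psd_scaleR: "psd A \<Longrightarrow> 0 \<le> c \<Longrightarrow> psd (c *\<^sub>R A)"
  by (auto simp: psd_def transpose_def vec_eq_iff simp flip: scaleR_matrix_vector_assoc)

lemma psd_zero: "psd 0"
  by (simp add: psd_def transpose_def vec_eq_iff)

lemma psd_sum: "(\<And>t. t \<in> T \<Longrightarrow> psd (f t)) \<Longrightarrow> psd (\<Sum>t\<in>T. f t)"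
  by (induction T rule: infinite_finite_induct) (simp_all add: psd_add psd_zero)

lemma psd_outer_square: "psd (outer_square v)"
proof -
  have "x \<bullet> (outer_square v *v x) = (v \<bullet> x)\<^sup>2" for x
    by (simp add: outer_square_def matrix_vector_mult_def inner_vec_def power2_eq_square
        sum_product sum_distrib_left mult_ac)
  moreover have "transpose (outer_square v) = outer_square v"
    by (simp add: outer_square_def transpose_def vec_eq_iff mult.commute)
  ultimately show ?thesis by (simp add: psd_def)
qed

lemma psd_Sigma_hat: "psd (Sigma_hat y n a b)"
  unfolding Sigma_hat_def by (intro psd_scaleR psd_sum psd_outer_square) simp

lemma trace_outer_square: "trace (outer_square v) = (norm v)\<^sup>2"
  by (simp add: trace_def outer_square_def power2_norm_eq_inner inner_vec_def)

lemma norm_outer_square: "norm (outer_square v) = (norm v)\<^sup>2"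
proof -
  have n: "(norm v)\<^sup>2 = (\<Sum>i\<in>UNIV. (v $ i)\<^sup>2)"
    by (simp add: norm_vec_def L2_set_def sum_nonneg)
  have "(\<Sum>i\<in>UNIV. \<Sum>j\<in>UNIV. (v $ i * v $ j)\<^sup>2) = ((norm v)\<^sup>2)\<^sup>2"
    unfolding n power2_eq_square[of "sum _ _"] sum_product power_mult_distrib ..
  thus ?thesis unfolding norm_eq_frobenius outer_square_def vec_lambda_beta
    by (simp only: real_sqrt_abs abs_power2)
qed

lemma trace_sum: "trace (\<Sum>t\<in>T. f t) = (\<Sum>t\<in>T. trace (f t :: real^'q::finite^'q))"
  unfolding trace_def sum_component by (rule sum.swap)

lemma trace_scaleR: "trace (c *\<^sub>R A) = c * trace (A :: real^'q::finite^'q)"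
  by (simp add: trace_def sum_distrib_left)

lemma tendsto_trace:
  "(f \<longlongrightarrow> A) F \<Longrightarrow> ((\<lambda>n. trace (f n)) \<longlongrightarrow> trace (A :: real^'q::finite^'q)) F"
  unfolding trace_def by (intro tendsto_intros)

lemma tendsto_det:
  "(f \<longlongrightarrow> A) F \<Longrightarrow> ((\<lambda>n. det (f n)) \<longlongrightarrow> det (A :: real^'q::finite^'q)) F"
  unfolding det_def by (intro tendsto_intros)

lemma continuous_on_det: "continuous_on S (det :: real^'q::finite^'q \<Rightarrow> real)"
  unfolding continuous_on_def by (auto intro: tendsto_det tendsto_ident_at)

section \<open>Uniform convergence of block moments\<close>

text \<open>Division by n, and not by k, makes every block a plain difference and gives positive
  semidefinite increments in k.\<close>

definition partial_moment :: "(nat \<Rightarrow> nat \<Rightarrow> real^'q::finite) \<Rightarrow> nat \<Rightarrow> nat \<Rightarrow> real^'q^'q" where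
  "partial_moment y n k = (1 / real n) *\<^sub>R (\<Sum>t\<in>{1..k}. outer_square (y n t))"

lemma partial_moment_diff:
  assumes "i \<le> j"
  shows "partial_moment y n j - partial_moment y n i = (1 / real n) *\<^sub>R (\<Sum>t\<in>{i+1..j}. outer_square (y n t))"
proof -
  have "{1..j} = {1..i} \<union> {i+1..j}" "{1..i} \<inter> {i+1..j} = {}" using assms by auto
  hence "(\<Sum>t\<in>{1..j}. outer_square (y n t)) =
      (\<Sum>t\<in>{1..i}. outer_square (y n t)) + (\<Sum>t\<in>{i+1..j}. outer_square (y n t))"
    by (simp add: sum.union_disjoint)
  thus ?thesis by (simp add: partial_moment_def scaleR_add_right)
qed

lemma Sigma_hat_eq_partial_moment:
  assumes "0 \<le> a" "a \<le> b"
  shows "((real (nat \<lfloor>b * real n\<rfloor>) - real (nat \<lfloor>a * real n\<rfloor>)) / real n) *\<^sub>R Sigma_hat y n a b =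
    partial_moment y n (nat \<lfloor>b * real n\<rfloor>) - partial_moment y n (nat \<lfloor>a * real n\<rfloor>)"
proof -
  let ?i = "nat \<lfloor>a * real n\<rfloor>" and ?j = "nat \<lfloor>b * real n\<rfloor>"
  have ij: "?i \<le> ?j" using assms by (intro nat_mono floor_mono mult_right_mono) auto
  show ?thesis
    unfolding partial_moment_diff[OF ij] Sigma_hat_def block_def
    \<comment> \<open>For an empty block the factor on the left and the difference on the right are
      both zero.\<close>
    using ij by (cases "?i = ?j") (auto simp: of_nat_diff)
qed

text \<open>For an outer square the Frobenius norm equals the trace, so the triangle inequality over
  the block already gives the increment of the trace.\<close>

lemma norm_partial_moment_diff_le:
  assumes "i \<le> j"
  shows "norm (partial_moment y n j - partial_moment y n i)
    \<le> trace (partial_moment y n j) - trace (partial_moment y n i)"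
proof -
  have "norm (\<Sum>t\<in>{i+1..j}. outer_square (y n t)) \<le> (\<Sum>t\<in>{i+1..j}. (norm (y n t))\<^sup>2)"
    by (rule order_trans[OF norm_sum]) (simp add: norm_outer_square)
  thus ?thesis unfolding trace_sub[symmetric] partial_moment_diff[OF assms]
    by (simp add: trace_scaleR trace_sum trace_outer_square divide_right_mono)
qed

lemma nat_floor_over_tendsto:
  assumes "0 \<le> a"
  shows "(\<lambda>n. real (nat \<lfloor>a * real n\<rfloor>) / real n) \<longlonglongrightarrow> a"
proof (rule LIM_zero_cancel, rule Lim_null_comparison)
  show "(\<lambda>n. 1 / real n) \<longlonglongrightarrow> 0" by (rule lim_1_over_n)
  show "\<forall>\<^sub>F n in sequentially. norm (real (nat \<lfloor>a * real n\<rfloor>) / real n - a) \<le> 1 / real n"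
    using eventually_gt_at_top[of 0]
  proof eventually_elim
    case (elim n)
    have "\<bar>real (nat \<lfloor>a * real n\<rfloor>) - a * real n\<bar> \<le> 1"
      using assms by (simp add: abs_le_iff) linarith
    hence "\<bar>real (nat \<lfloor>a * real n\<rfloor>) - a * real n\<bar> / real n \<le> 1 / real n"
      by (rule divide_right_mono) simp
    moreover have "real (nat \<lfloor>a * real n\<rfloor>) / real n - a = (real (nat \<lfloor>a * real n\<rfloor>) - a * real n) / real n"
      using elim by (simp add: field_simps)
    ultimately show ?case by simp
  qed
qed

text \<open>This is the integral from 0 to \<nu> of the step function that jumps from
  \<open>L\<close> to \<open>R\<close> at \<theta>; hence it is Lipschitz although the step function
  jumps.\<close>

definition limit_moment :: "real \<Rightarrow> real^'q::finite^'q \<Rightarrow> real^'q^'q \<Rightarrow> real \<Rightarrow> real^'q^'q" where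
  "limit_moment \<theta> L R \<nu> = min \<nu> \<theta> *\<^sub>R L + max (\<nu> - \<theta>) 0 *\<^sub>R R"

lemma limit_moment_left: "0 < \<nu> \<Longrightarrow> limit_moment \<theta> L R \<nu> = \<nu> *\<^sub>R Sigma_left \<theta> L R \<nu>"
  by (auto simp: limit_moment_def Sigma_left_def scaleR_add_right min_def max_def)

lemma limit_moment_right:
  assumes "\<nu> < 1" "\<theta> < 1"
  shows "limit_moment \<theta> L R 1 - limit_moment \<theta> L R \<nu> = (1 - \<nu>) *\<^sub>R Sigma_right \<theta> L R \<nu>"
proof -
  have "limit_moment \<theta> L R 1 - limit_moment \<theta> L R \<nu>
      = (\<theta> - min \<nu> \<theta>) *\<^sub>R L + (1 - \<theta> - max (\<nu> - \<theta>) 0) *\<^sub>R R"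
    using assms by (simp add: limit_moment_def scaleR_diff_left)
  also have "\<dots> = (1 - \<nu>) *\<^sub>R Sigma_right \<theta> L R \<nu>"
    using assms by (auto simp: Sigma_right_def scaleR_add_right)
  finally show ?thesis .
qed

lemma limit_moment_lipschitz:
  "norm (limit_moment \<theta> L R \<mu> - limit_moment \<theta> L R \<nu>) \<le> (norm L + norm R) * \<bar>\<mu> - \<nu>\<bar>"
proof -
  have "limit_moment \<theta> L R \<mu> - limit_moment \<theta> L R \<nu>
      = (min \<mu> \<theta> - min \<nu> \<theta>) *\<^sub>R L + (max (\<mu> - \<theta>) 0 - max (\<nu> - \<theta>) 0) *\<^sub>R R"
    by (simp add: limit_moment_def scaleR_diff_left)
  also have "norm \<dots> \<le> \<bar>min \<mu> \<theta> - min \<nu> \<theta>\<bar> * norm L + \<bar>max (\<mu> - \<theta>) 0 - max (\<nu> - \<theta>) 0\<bar> * norm R"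
    by (rule order_trans[OF norm_triangle_ineq]) simp
  also have "\<dots> \<le> \<bar>\<mu> - \<nu>\<bar> * norm L + \<bar>\<mu> - \<nu>\<bar> * norm R"
    by (intro add_mono mult_right_mono) auto
  finally show ?thesis by (simp add: algebra_simps)
qed

lemma trace_limit_moment_lipschitz:
  "\<bar>trace (limit_moment \<theta> L R \<mu>) - trace (limit_moment \<theta> L R \<nu>)\<bar> \<le> (\<bar>trace L\<bar> + \<bar>trace R\<bar>) * \<bar>\<mu> - \<nu>\<bar>"
proof -
  have "trace (limit_moment \<theta> L R \<mu>) - trace (limit_moment \<theta> L R \<nu>)
      = (min \<mu> \<theta> - min \<nu> \<theta>) * trace L + (max (\<mu> - \<theta>) 0 - max (\<nu> - \<theta>) 0) * trace R"
    by (simp add: limit_moment_def trace_add trace_scaleR algebra_simps)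
  also have "\<bar>\<dots>\<bar> \<le> \<bar>min \<mu> \<theta> - min \<nu> \<theta>\<bar> * \<bar>trace L\<bar> + \<bar>max (\<mu> - \<theta>) 0 - max (\<nu> - \<theta>) 0\<bar> * \<bar>trace R\<bar>"
    by (rule order_trans[OF abs_triangle_ineq]) (simp add: abs_mult)
  also have "\<dots> \<le> \<bar>\<mu> - \<nu>\<bar> * \<bar>trace L\<bar> + \<bar>\<mu> - \<nu>\<bar> * \<bar>trace R\<bar>"
    by (intro add_mono mult_right_mono) auto
  finally show ?thesis by (simp add: algebra_simps)
qed

text \<open>The hypotheses cover only blocks on one side of \<theta>, so beyond \<theta> the sum is
  split there and each piece has its own limit.\<close>

lemma partial_moment_tendsto:
  fixes y :: "nat \<Rightarrow> nat \<Rightarrow> real^'q::finite"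
  assumes theta: "0 < \<theta>" "\<theta> < 1"
    and left: "\<And>a b. 0 \<le> a \<Longrightarrow> a < b \<Longrightarrow> b \<le> \<theta> \<Longrightarrow> (\<lambda>n. Sigma_hat y n a b) \<longlonglongrightarrow> L"
    and right: "\<And>a b. \<theta> \<le> a \<Longrightarrow> a < b \<Longrightarrow> b \<le> 1 \<Longrightarrow> (\<lambda>n. Sigma_hat y n a b) \<longlonglongrightarrow> R"
    and \<nu>: "0 \<le> \<nu>" "\<nu> \<le> 1"
  shows "(\<lambda>n. partial_moment y n (nat \<lfloor>\<nu> * real n\<rfloor>)) \<longlonglongrightarrow> limit_moment \<theta> L R \<nu>"
proof -
  have incr: "(\<lambda>n. partial_moment y n (nat \<lfloor>b * real n\<rfloor>) - partial_moment y n (nat \<lfloor>a * real n\<rfloor>))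
      \<longlonglongrightarrow> (b - a) *\<^sub>R S"
    if "0 \<le> a" "a \<le> b" "(\<lambda>n. Sigma_hat y n a b) \<longlonglongrightarrow> S" for a b S
    unfolding Sigma_hat_eq_partial_moment[OF that(1,2), symmetric] diff_divide_distrib
    using that by (intro tendsto_intros nat_floor_over_tendsto) auto
  have first: "(\<lambda>n. partial_moment y n (nat \<lfloor>b * real n\<rfloor>)) \<longlonglongrightarrow> b *\<^sub>R L" if "0 \<le> b" "b \<le> \<theta>" for b
  proof (cases "b = 0")
    case False
    with incr[of 0 b L] left[of 0 b] that show ?thesis by (simp add: partial_moment_def)
  qed (simp add: partial_moment_def)
  show ?thesis
  proof (cases "\<nu> \<le> \<theta>")
    case True
    thus ?thesis using first[of \<nu>] \<nu> by (simp add: limit_moment_def min_def max_def)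
  next
    case False
    have "(\<lambda>n. (partial_moment y n (nat \<lfloor>\<nu> * real n\<rfloor>) - partial_moment y n (nat \<lfloor>\<theta> * real n\<rfloor>))
        + partial_moment y n (nat \<lfloor>\<theta> * real n\<rfloor>)) \<longlonglongrightarrow> (\<nu> - \<theta>) *\<^sub>R R + \<theta> *\<^sub>R L"
      using False theta \<nu> by (intro tendsto_add incr first right) auto
    thus ?thesis using False by (simp add: limit_moment_def min_def max_def add.commute)
  qed
qed

text \<open>Polya's argument: the trace of \<^const>\<open>partial_moment\<close> is monotone and dominates its increments
  in norm, so pointwise convergence on a fine enough partition is uniform.\<close>

lemma partial_moment_uniform:
  fixes y :: "nat \<Rightarrow> nat \<Rightarrow> real^'q::finite"
  assumes lim: "\<And>\<nu>. 0 \<le> \<nu> \<Longrightarrow> \<nu> \<le> 1 \<Longrightarrow>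
      (\<lambda>n. partial_moment y n (nat \<lfloor>\<nu> * real n\<rfloor>)) \<longlonglongrightarrow> limit_moment \<theta> L R \<nu>"
    and e: "0 < e"
  shows "\<forall>\<^sub>F n in sequentially. \<forall>k\<le>n. norm (partial_moment y n k - limit_moment \<theta> L R (real k / real n)) < e"
proof -
  define C where "C = norm L + norm R + (\<bar>trace L\<bar> + \<bar>trace R\<bar>)"
  let ?G = "limit_moment \<theta> L R"
  have C0: "0 \<le> C" by (simp add: C_def)
  have C1: "norm (?G \<mu> - ?G \<nu>) \<le> C * \<bar>\<mu> - \<nu>\<bar>" for \<mu> \<nu>
    by (rule order_trans[OF limit_moment_lipschitz]) (auto simp: C_def intro!: mult_right_mono)
  have C2: "\<bar>trace (?G \<mu>) - trace (?G \<nu>)\<bar> \<le> C * \<bar>\<mu> - \<nu>\<bar>" for \<mu> \<nu>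
    by (rule order_trans[OF trace_limit_moment_lipschitz]) (auto simp: C_def intro!: mult_right_mono)
  \<comment> \<open>With mesh cost C / m below e / 8, the trace increment over one cell is below 3 e
    / 8, and the error at the left node and the move of the limit within the cell add e / 8 each: 5
    e / 8 in total.\<close>
  obtain m :: nat where m: "8 * C / e < real m" "0 < m"
    by (metis reals_Archimedean2 gr_zeroI less_le_trans of_nat_0_le_iff of_nat_0 C0 e divide_nonneg_pos
        mult_nonneg_nonneg not_less zero_le_numeral)
  have mesh: "C / real m < e / 8" using m e by (simp add: field_simps)
  \<comment> \<open>The cap at 1 matters for k = n: then the cell index is i = m, and the right node
    i + 1 = m + 1 must still be an admissible fraction.\<close>
  define u where "u i = min (real i / real m) 1" for i
  have u: "0 \<le> u i" "u i \<le> 1" for i by (auto simp: u_def)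
  let ?P = "\<lambda>n \<nu>. partial_moment y n (nat \<lfloor>\<nu> * real n\<rfloor>)"
  have "\<forall>\<^sub>F n in sequentially. norm (?P n (u i) - ?G (u i)) < e / 8 \<and>
      \<bar>trace (?P n (u i)) - trace (?G (u i))\<bar> < e / 8" for i
    using tendstoD[OF lim[OF u] , of "e/8" i] tendstoD[OF tendsto_trace[OF lim[OF u]], of "e/8" i] e
    by (auto simp: dist_norm intro: eventually_conj)
  hence "\<forall>\<^sub>F n in sequentially. \<forall>i\<in>{..m+1}. norm (?P n (u i) - ?G (u i)) < e / 8 \<and>
      \<bar>trace (?P n (u i)) - trace (?G (u i))\<bar> < e / 8"
    by (intro eventually_ball_finite) auto
  with eventually_gt_at_top[of 0] show ?thesis
  proof eventually_elim
    case (elim n)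
    show ?case
    proof (intro allI impI)
      fix k assume k: "k \<le> n"
      define i where "i = (k * m) div n"
      have "(k * m) div n \<le> (n * m) div n" by (intro div_le_mono mult_le_mono1 k)
      hence im: "i \<le> m" using elim(1) by (simp add: i_def)
      have "i * n \<le> k * m" by (simp add: i_def)
      hence r1: "real i * real n \<le> real k * real m" by (metis of_nat_le_iff of_nat_mult)
      have "k * m < (i + 1) * n" using elim(1) unfolding i_def by (simp add: dividend_less_times_div algebra_simps)
      hence r2: "real k * real m < (real i + 1) * real n" by (metis of_nat_less_iff of_nat_mult of_nat_Suc Suc_eq_plus1 add.commute)
      have ui: "u i = real i / real m" using im m by (simp add: u_def min_def)
      have lo: "u i * real n \<le> real k" using r1 m by (simp add: ui field_simps)
      have hi: "real k \<le> u (i + 1) * real n"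
      proof (cases "real (i + 1) / real m \<le> 1")
        case True
        thus ?thesis using r2 m by (simp add: u_def min_def field_simps)
      next
        case False
        thus ?thesis using k by (simp add: u_def min_def)
      qed
      have gap: "u (i + 1) - u i \<le> 1 / real m" using m by (auto simp: u_def min_def field_simps)
      have klo: "nat \<lfloor>u i * real n\<rfloor> \<le> k" using lo by linarith
      have khi: "k \<le> nat \<lfloor>u (i + 1) * real n\<rfloor>" using hi by linarith
      have uk: "u i \<le> real k / real n" "real k / real n \<le> u (i + 1)"
        using lo hi elim(1) by (auto simp: field_simps)
      have i_in: "i \<in> {..m+1}" "i + 1 \<in> {..m+1}" using im by auto
      have a: "norm (?P n (u i) - ?G (u i)) < e / 8" "\<bar>trace (?P n (u i)) - trace (?G (u i))\<bar> < e / 8"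
        "\<bar>trace (?P n (u (i+1))) - trace (?G (u (i+1)))\<bar> < e / 8" using elim(2) i_in by blast+
      have "norm (partial_moment y n k - ?P n (u i)) \<le> trace (partial_moment y n k) - trace (?P n (u i))"
        by (rule norm_partial_moment_diff_le[OF klo])
      moreover have "trace (partial_moment y n k) \<le> trace (?P n (u (i+1)))"
        using order_trans[OF norm_ge_zero norm_partial_moment_diff_le[OF khi, of y n]] by simp
      moreover have "C * \<bar>u (i+1) - u i\<bar> \<le> C / real m"
        using gap uk C0 mult_left_mono[of "\<bar>u (i+1) - u i\<bar>" "1 / real m" C] by simp
      with C2[of "u (i+1)" "u i"] have "trace (?G (u (i+1))) - trace (?G (u i)) \<le> C / real m" by linarith
      moreover have "C * \<bar>u i - real k / real n\<bar> \<le> C / real m"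
        using gap uk C0 mult_left_mono[of "\<bar>u i - real k / real n\<bar>" "1 / real m" C] by simp
      with C1[of "u i" "real k / real n"] have "norm (?G (u i) - ?G (real k / real n)) \<le> C / real m"
        by linarith
      moreover have "norm (partial_moment y n k - ?G (real k / real n)) \<le>
          norm (partial_moment y n k - ?P n (u i)) + norm (?P n (u i) - ?G (u i))
          + norm (?G (u i) - ?G (real k / real n))"
        using norm_triangle_ineq[of "partial_moment y n k - ?P n (u i)" "?P n (u i) - ?G (u i)"]
          norm_triangle_ineq[of "partial_moment y n k - ?G (u i)" "?G (u i) - ?G (real k / real n)"]
        by simp
      ultimately show "norm (partial_moment y n k - ?G (real k / real n)) < e" using a mesh e by linarith
    qed
  qed
qed

text \<open>Multiplied by its relative length, a block moment is a partial moment or a difference of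
  two of them; the right block uses two, hence the tolerance e / 2 for each. Close to the endpoints
  the weight absorbs averages over few observations.\<close>

lemma block_moments_uniform:
  fixes y :: "nat \<Rightarrow> nat \<Rightarrow> real^'q::finite"
  assumes theta: "0 < \<theta>" "\<theta> < 1"
    and left: "\<And>a b. 0 \<le> a \<Longrightarrow> a < b \<Longrightarrow> b \<le> \<theta> \<Longrightarrow> (\<lambda>n. Sigma_hat y n a b) \<longlonglongrightarrow> L"
    and right: "\<And>a b. \<theta> \<le> a \<Longrightarrow> a < b \<Longrightarrow> b \<le> 1 \<Longrightarrow> (\<lambda>n. Sigma_hat y n a b) \<longlonglongrightarrow> R"
    and e: "0 < e"
  shows "\<forall>\<^sub>F n in sequentially. \<forall>\<nu>\<in>grid n.
      \<nu> * norm (Sigma_hat y n 0 \<nu> - Sigma_left \<theta> L R \<nu>) < e \<and>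
      (1 - \<nu>) * norm (Sigma_hat y n \<nu> 1 - Sigma_right \<theta> L R \<nu>) < e"
proof -
  let ?G = "limit_moment \<theta> L R"
  have "\<forall>\<^sub>F n in sequentially. \<forall>k\<le>n. norm (partial_moment y n k - ?G (real k / real n)) < e / 2"
    using partial_moment_tendsto[OF theta left right] e by (intro partial_moment_uniform) auto
  with eventually_gt_at_top[of 0] show ?thesis
  proof eventually_elim
    case (elim n)
    show ?case
    proof
      fix \<nu> assume "\<nu> \<in> grid n"
      then obtain k where k: "1 \<le> k" "k < n" "\<nu> = real k / real n" by (auto simp: grid_def)
      have \<nu>: "0 < \<nu>" "\<nu> < 1" "\<nu> * real n = real k" using k by auto
      have P: "norm (partial_moment y n k - ?G \<nu>) < e / 2" using elim(2) k by simp
      have Q: "norm (partial_moment y n n - ?G 1) < e / 2" using elim spec[of _ n] by fastforce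
      have "\<nu> *\<^sub>R Sigma_hat y n 0 \<nu> = partial_moment y n k"
        using Sigma_hat_eq_partial_moment[of 0 \<nu> n y] \<nu> k by (simp add: partial_moment_def)
      hence "\<nu> *\<^sub>R (Sigma_hat y n 0 \<nu> - Sigma_left \<theta> L R \<nu>) = partial_moment y n k - ?G \<nu>"
        by (simp add: limit_moment_left[OF \<nu>(1)] scaleR_diff_right)
      hence 1: "\<nu> * norm (Sigma_hat y n 0 \<nu> - Sigma_left \<theta> L R \<nu>) < e / 2"
        using P \<nu> by (metis abs_of_pos norm_scaleR)
      have "(1 - \<nu>) *\<^sub>R Sigma_hat y n \<nu> 1 = partial_moment y n n - partial_moment y n k"
        using Sigma_hat_eq_partial_moment[of \<nu> 1 n y] \<nu> k by (simp add: diff_divide_distrib)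
      hence "(1 - \<nu>) *\<^sub>R (Sigma_hat y n \<nu> 1 - Sigma_right \<theta> L R \<nu>)
          = (partial_moment y n n - ?G 1) - (partial_moment y n k - ?G \<nu>)"
        using limit_moment_right[OF \<nu>(2) theta(2), of L R] by (simp add: scaleR_diff_right algebra_simps)
      hence "(1 - \<nu>) * norm (Sigma_hat y n \<nu> 1 - Sigma_right \<theta> L R \<nu>)
          = norm ((partial_moment y n n - ?G 1) - (partial_moment y n k - ?G \<nu>))"
        using \<nu> by (metis abs_of_pos diff_gt_0_iff_gt norm_scaleR)
      also have "\<dots> < e"
        using norm_triangle_ineq4[of "partial_moment y n n - ?G 1" "partial_moment y n k - ?G \<nu>"] P Q by linarith
      finally show "\<nu> * norm (Sigma_hat y n 0 \<nu> - Sigma_left \<theta> L R \<nu>) < e \<and>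
          (1 - \<nu>) * norm (Sigma_hat y n \<nu> 1 - Sigma_right \<theta> L R \<nu>) < e" using 1 e by simp
    qed
  qed
qed

section \<open>Uniform estimates for the log-determinant\<close>

text \<open>The segment is compact and lies in the open set of matrices with positive determinant,
  so a closed neighbourhood of it does too. On that compact neighbourhood ln det is uniformly
  continuous, which makes the radius independent of t. \<open>Y\<close> may be any matrix.\<close>

lemma ln_det_uniform_near_segment:
  fixes A B :: "real^'q::finite^'q"
  assumes A: "pos_def A" and B: "pos_def B" and e: "0 < e"
  obtains r where "0 < r" "\<And>t Y. 0 \<le> t \<Longrightarrow> t \<le> 1 \<Longrightarrow> norm (Y - ((1 - t) *\<^sub>R A + t *\<^sub>R B)) < r \<Longrightarrow>
     0 < det Y \<and> \<bar>ln (det Y) - ln (det ((1 - t) *\<^sub>R A + t *\<^sub>R B))\<bar> < e"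
proof -
  define S where "S = (\<lambda>t. (1 - t) *\<^sub>R A + t *\<^sub>R B) ` {0..1}"
  define D where "D = {Y :: real^'q^'q. 0 < det Y}"
  have "compact S" unfolding S_def by (intro compact_continuous_image continuous_intros) auto
  moreover have "open D" unfolding D_def
    by (intro open_Collect_less continuous_on_const continuous_on_det)
  moreover have "S \<subseteq> D" using pos_def_det_pos[OF pos_def_combine[OF A B]] by (auto simp: S_def D_def)
  ultimately obtain s where s: "0 < s" "(\<Union>x\<in>S. cball x s) \<subseteq> D"
    by (rule compact_subset_open_imp_cball_epsilon_subset)
  define T where "T = (\<Union>x\<in>S. cball x s)"
  \<comment> \<open>The closed neighbourhood is the sum of the segment and a closed ball at the
    origin; a sum of two compact sets is compact.\<close>
  have "T = (\<Union>x\<in>S. \<Union>z\<in>cball 0 s. {x + z})"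
  proof -
    have "cball x s = (\<Union>z\<in>cball 0 s. {x + z})" for x :: "real^'q^'q"
    proof (intro set_eqI iffI)
      fix w assume "w \<in> cball x s"
      hence "w - x \<in> cball 0 s" by (simp add: dist_norm norm_minus_commute)
      thus "w \<in> (\<Union>z\<in>cball 0 s. {x + z})" by (intro UN_I[of "w - x"]) auto
    qed (auto simp: dist_norm)
    thus ?thesis unfolding T_def by (intro SUP_cong refl)
  qed
  moreover have "compact \<dots>"
    by (rule compact_sums'[OF \<open>compact S\<close> compact_cball])
  ultimately have "compact T" by simp
  moreover have "continuous_on T (\<lambda>Y. ln (det Y))"
    using s(2) by (intro continuous_on_ln continuous_on_det) (auto simp: T_def D_def)
  ultimately have "uniformly_continuous_on T (\<lambda>Y. ln (det Y))" by (rule compact_uniformly_continuous[rotated])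
  then obtain d where d: "0 < d" "\<And>x x'. x \<in> T \<Longrightarrow> x' \<in> T \<Longrightarrow> dist x' x < d \<Longrightarrow> dist (ln (det x')) (ln (det x)) < e"
    using e unfolding uniformly_continuous_on_def by metis
  show ?thesis
  proof (rule that[of "min s d"])
    fix t :: real and Y assume t: "0 \<le> t" "t \<le> 1" and Y: "norm (Y - ((1 - t) *\<^sub>R A + t *\<^sub>R B)) < min s d"
    let ?X = "(1 - t) *\<^sub>R A + t *\<^sub>R B"
    have X: "?X \<in> S" using t by (auto simp: S_def)
    hence XT: "?X \<in> T" using s(1) unfolding T_def by (intro UN_I[of ?X]) auto
    have YT: "Y \<in> T" using X Y unfolding T_def
      by (intro UN_I[of ?X]) (auto simp: dist_norm norm_minus_commute)
    have "dist Y ?X < d" using Y by (simp add: dist_norm)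
    with d(2)[OF XT YT] have "\<bar>ln (det Y) - ln (det ?X)\<bar> < e" by (simp add: dist_real_def)
    moreover have "Y \<in> D" using s(2) YT unfolding T_def by blast
    ultimately show "0 < det Y \<and> \<bar>ln (det Y) - ln (det ?X)\<bar> < e" by (simp add: D_def)
  qed (use s d in auto)
qed

text \<open>Near \<open>w = 0\<close> no control of \<open>W\<close> is available beyond \<open>norm W = O(1 / w)\<close>; the logarithm turns this
  into \<open>O(w * ln (1 / w))\<close>.\<close>

lemma weighted_ln_det_uniform:
  fixes L R :: "real^'q::finite^'q"
  assumes L: "psd L" and R: "psd R" and \<epsilon>: "0 < \<epsilon>" and e: "0 < e"
  obtains r where "0 < r" "\<And>w t W. 0 < w \<Longrightarrow> w \<le> 1 \<Longrightarrow> 0 \<le> t \<Longrightarrow> t \<le> 1 \<Longrightarrow> psd W \<Longrightarrow>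
     w * norm (W - ((1 - t) *\<^sub>R L + t *\<^sub>R R)) < r \<Longrightarrow>
     w * \<bar>ln (det (W + \<epsilon> *\<^sub>R mat 1)) - ln (det ((1 - t) *\<^sub>R L + t *\<^sub>R R + \<epsilon> *\<^sub>R mat 1))\<bar> < e"
proof -
  let ?q = "real CARD('q)"
  define A where "A = L + \<epsilon> *\<^sub>R mat 1"
  define B where "B = R + \<epsilon> *\<^sub>R mat 1"
  have AB: "pos_def A" "pos_def B"
    using L R \<epsilon> by (auto simp: A_def B_def intro: psd_add_scaled_id_pos_def)
  have comb: "(1 - t) *\<^sub>R A + t *\<^sub>R B = (1 - t) *\<^sub>R L + t *\<^sub>R R + \<epsilon> *\<^sub>R mat 1" for t
    by (simp add: A_def B_def algebra_simps)
  obtain r1 where r1: "0 < r1" "\<And>t Y. 0 \<le> t \<Longrightarrow> t \<le> 1 \<Longrightarrow> norm (Y - ((1 - t) *\<^sub>R A + t *\<^sub>R B)) < r1 \<Longrightarrow>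
     0 < det Y \<and> \<bar>ln (det Y) - ln (det ((1 - t) *\<^sub>R A + t *\<^sub>R B))\<bar> < e"
    using ln_det_uniform_near_segment[OF AB e] by metis
  define M where "M = norm L + norm R"
  \<comment> \<open>For w at most 1, D / w dominates both \<open>norm W + \<epsilon>\<close>, where
    \<open>norm W\<close> is at most M + 1 / w, and the corresponding quantity of the limit.\<close>
  define D where "D = M + 1 + \<epsilon>"
  have D: "0 < D" "M + \<epsilon> \<le> D" using \<epsilon> by (auto simp: D_def M_def add_nonneg_pos)
  \<comment> \<open>This bounds the weighted difference for small w: the logarithmic bounds give w q
    (ln (D / \<epsilon>) + ln (1 / w)), and ln (1 / w) = 2 ln (1 / sqrt w) is at most 2 / sqrt w. It
    vanishes as w tends to 0.\<close>
  define \<phi> where "\<phi> w = ?q * (w * ln (D / \<epsilon>) + 2 * sqrt w)" for w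
  have "isCont \<phi> 0" unfolding \<phi>_def by (intro continuous_intros)
  hence "\<forall>\<^sub>F w in at_right 0. \<phi> w < e"
    using e by (intro order_tendstoD[of \<phi> "\<phi> 0"]) (auto simp: \<phi>_def isCont_def filterlim_at_split)
  then obtain \<eta> where \<eta>: "0 < \<eta>" "\<And>w. 0 < w \<Longrightarrow> w < \<eta> \<Longrightarrow> \<phi> w < e"
    unfolding eventually_at_right_field by auto
  have bounds: "?q * ln \<epsilon> \<le> ln (det (X + \<epsilon> *\<^sub>R mat 1)) \<and> ln (det (X + \<epsilon> *\<^sub>R mat 1)) \<le> ?q * ln c"
    if X: "psd X" and c: "norm X + \<epsilon> \<le> c" for X :: "real^'q^'q" and c
  proof -
    have pos: "0 < norm X + \<epsilon>" using \<epsilon> by (simp add: add_nonneg_pos)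
    have "ln (\<epsilon> ^ CARD('q)) \<le> ln (det (X + \<epsilon> *\<^sub>R mat 1))"
      using det_psd_add_scaled_id_bounds[OF X \<epsilon>] \<epsilon>
      by (intro ln_mono) (auto intro: less_le_trans[of _ "\<epsilon> ^ CARD('q)"])
    moreover have "ln (det (X + \<epsilon> *\<^sub>R mat 1)) \<le> ln ((norm X + \<epsilon>) ^ CARD('q))"
      using det_psd_add_scaled_id_bounds[OF X \<epsilon>] \<epsilon> pos
      by (intro ln_mono) (auto intro: less_le_trans[of _ "\<epsilon> ^ CARD('q)"])
    moreover have "ln (norm X + \<epsilon>) \<le> ln c" using c pos by simp
    ultimately show ?thesis using \<epsilon> pos by (auto simp: ln_realpow intro: order_trans mult_left_mono)
  qed
  show ?thesis
  \<comment> \<open>The bound 1 serves weights below \<eta>, where it limits \<open>norm W\<close>;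
    the bound \<eta> r1 serves the others, where dividing by the weight leaves a distance below
    r1.\<close>
  proof (rule that[of "min 1 (\<eta> * r1)"])
    fix w t :: real and W :: "real^'q^'q"
    let ?X = "(1 - t) *\<^sub>R L + t *\<^sub>R R"
    assume w: "0 < w" "w \<le> 1" and t: "0 \<le> t" "t \<le> 1" and W: "psd W"
      and close: "w * norm (W - ?X) < min 1 (\<eta> * r1)"
    show "w * \<bar>ln (det (W + \<epsilon> *\<^sub>R mat 1)) - ln (det (?X + \<epsilon> *\<^sub>R mat 1))\<bar> < e"
    proof (cases "w < \<eta>")
      case False
      have "\<eta> * norm (W - ?X) \<le> w * norm (W - ?X)" using False by (intro mult_right_mono) auto
      hence "\<eta> * norm (W - ?X) < \<eta> * r1" using close by linarith
      hence "norm ((W + \<epsilon> *\<^sub>R mat 1) - ((1 - t) *\<^sub>R A + t *\<^sub>R B)) < r1" using \<eta>(1) by (simp add: comb)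
      hence "\<bar>ln (det (W + \<epsilon> *\<^sub>R mat 1)) - ln (det (?X + \<epsilon> *\<^sub>R mat 1))\<bar> < e"
        using r1(2)[OF t] by (simp add: comb)
      moreover have "w * \<bar>ln (det (W + \<epsilon> *\<^sub>R mat 1)) - ln (det (?X + \<epsilon> *\<^sub>R mat 1))\<bar>
          \<le> \<bar>ln (det (W + \<epsilon> *\<^sub>R mat 1)) - ln (det (?X + \<epsilon> *\<^sub>R mat 1))\<bar>"
        using w by (intro mult_left_le_one_le) auto
      ultimately show ?thesis by linarith
    next
      case True
      have "norm ?X \<le> (1 - t) * norm L + t * norm R"
        using t by (intro order_trans[OF norm_triangle_ineq]) simp
      also have "\<dots> \<le> M" unfolding M_def using t by (intro add_mono mult_left_le_one_le) auto
      finally have nX: "norm ?X \<le> M" .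
      have "norm (W - ?X) < 1 / w" using close w by (simp add: field_simps)
      hence "norm W \<le> M + 1 / w" using nX norm_triangle_ineq[of "W - ?X" ?X] by simp
      moreover have "M + \<epsilon> \<le> (M + \<epsilon>) / w"
      proof -
        have "0 \<le> M + \<epsilon>" using \<epsilon> by (simp add: M_def)
        hence "(M + \<epsilon>) * w \<le> M + \<epsilon>" using w by (intro mult_left_le) auto
        thus ?thesis using w by (simp add: pos_le_divide_eq)
      qed
      ultimately have nW: "norm W + \<epsilon> \<le> D / w" by (simp add: D_def add_divide_distrib)
      have "D \<le> D / w" using w D by (simp add: field_simps)
      hence nX': "norm ?X + \<epsilon> \<le> D / w" using nX D by linarith
      have psdX: "psd ?X" using L R t by (intro psd_add psd_scaleR) auto
      have "\<bar>ln (det (W + \<epsilon> *\<^sub>R mat 1)) - ln (det (?X + \<epsilon> *\<^sub>R mat 1))\<bar> \<le> ?q * ln (D / w) - ?q * ln \<epsilon>"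
        using bounds[OF W nW] bounds[OF psdX nX'] by linarith
      also have "\<dots> = ?q * (ln (D / \<epsilon>) + ln (1 / w))"
        using D w \<epsilon> by (simp add: ln_div algebra_simps)
      finally have "w * \<bar>ln (det (W + \<epsilon> *\<^sub>R mat 1)) - ln (det (?X + \<epsilon> *\<^sub>R mat 1))\<bar>
          \<le> w * (?q * (ln (D / \<epsilon>) + ln (1 / w)))" using w by (intro mult_left_mono) auto
      also have "ln (1 / w) \<le> 2 / sqrt w"
      proof -
        have "ln (1 / w) = 2 * ln (1 / sqrt w)" using w by (simp add: ln_div ln_sqrt)
        also have "ln (1 / sqrt w) \<le> 1 / sqrt w" using w by (intro less_imp_le ln_less_self) simp
        finally show ?thesis by simp
      qed
      hence "w * (?q * (ln (D / \<epsilon>) + ln (1 / w))) \<le> w * (?q * (ln (D / \<epsilon>) + 2 / sqrt w))"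
        using w by (intro mult_left_mono add_left_mono) auto
      also have "\<dots> = ?q * (w * ln (D / \<epsilon>) + 2 * (w / sqrt w))" by (simp add: algebra_simps)
      also have "\<dots> = \<phi> w" using w by (simp add: \<phi>_def real_div_sqrt)
      also have "\<phi> w < e" using \<eta>(2) w True by simp
      finally show ?thesis .
    qed
  qed (use \<eta> r1 in auto)
qed

section \<open>The limiting objective\<close>

text \<open>The coefficient written with \<open>max\<close> is a single formula for every real \<nu>
  with denominator at least \<theta>, so both convexity and continuity can be read off without
  cases, at the endpoints too.\<close>

lemma Sigma_left_combination:
  fixes \<theta> \<nu> :: real
  assumes "0 < \<theta>"
  defines "t \<equiv> max 0 (\<nu> - \<theta>) / max \<nu> \<theta>"
  shows "Sigma_left \<theta> L R \<nu> = (1 - t) *\<^sub>R L + t *\<^sub>R R" "0 \<le> t" "t \<le> 1"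
proof -
  show "0 \<le> t" "t \<le> 1" using assms by (auto simp: t_def max_def)
  show "Sigma_left \<theta> L R \<nu> = (1 - t) *\<^sub>R L + t *\<^sub>R R"
  proof (cases "\<nu> \<le> \<theta>")
    case True
    thus ?thesis by (simp add: Sigma_left_def t_def)
  next
    case False
    hence "t = (\<nu> - \<theta>) / \<nu>" "1 - t = \<theta> / \<nu>" using assms by (auto simp: t_def field_simps)
    thus ?thesis using False by (simp add: Sigma_left_def)
  qed
qed

text \<open>Reversal of time. The identity is exact also at \<nu> = \<theta>, because the strict
  comparison in one definition is the complement of the weak one in the other.\<close>

lemma Sigma_right_mirror: "Sigma_right \<theta> L R \<nu> = Sigma_left (1 - \<theta>) R L (1 - \<nu>)"
  by (simp add: Sigma_right_def Sigma_left_def add.commute)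

lemma J_inf_inner_mirror: "J_inf_inner \<theta> \<epsilon> L R \<nu> = J_inf_inner (1 - \<theta>) \<epsilon> R L (1 - \<nu>)"
  using Sigma_right_mirror[of "1 - \<theta>" R L "1 - \<nu>"]
  by (simp add: J_inf_inner_def Sigma_right_mirror[of \<theta>])

lemma regularized_combination:
  "(1 - t) *\<^sub>R L + t *\<^sub>R R + \<epsilon> *\<^sub>R mat 1
    = (1 - t) *\<^sub>R (L + \<epsilon> *\<^sub>R mat 1) + t *\<^sub>R (R + \<epsilon> *\<^sub>R mat 1 :: real^'q::finite^'q)"
  by (simp add: algebra_simps)

text \<open>Left of \<theta> the first block is homogeneous, so only the second matrix moves; w is
  the share of that block lying after \<theta>.\<close>

lemma J_inf_inner_left:
  assumes "0 < \<theta>" "\<theta> < 1" "\<nu> \<le> \<theta>"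
  defines "w \<equiv> (1 - \<theta>) / (1 - \<nu>)"
  shows "J_inf_inner \<theta> \<epsilon> L R \<nu> = \<nu> * ln (det (L + \<epsilon> *\<^sub>R mat 1)) +
    (1 - \<nu>) * ln (det ((1 - w) *\<^sub>R (L + \<epsilon> *\<^sub>R mat 1) + w *\<^sub>R (R + \<epsilon> *\<^sub>R mat 1)))"
proof -
  have "Sigma_right \<theta> L R \<nu> = (1 - w) *\<^sub>R L + w *\<^sub>R R"
  proof (cases "\<nu> = \<theta>")
    case False
    hence "1 - w = (\<theta> - \<nu>) / (1 - \<nu>)" using assms by (simp add: w_def field_simps)
    thus ?thesis using False assms by (simp add: Sigma_right_def w_def)
  qed (use assms in \<open>simp add: Sigma_right_def w_def\<close>)
  thus ?thesis using assms
    by (simp add: J_inf_inner_def Sigma_left_def regularized_combination del: scaleR_add_right)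
qed

text \<open>Strong concavity at w yields a gain w (1 - w) N. After multiplication by 1 - \<nu> the
  first factor becomes 1 - \<theta>, while 1 - w = (\<theta> - \<nu>) / (1 - \<nu>) is at least
  \<theta> - \<nu>; hence a linear bound.\<close>

lemma J_inf_inner_lower_left:
  fixes L R :: "real^'q::finite^'q"
  assumes theta: "0 < \<theta>" "\<theta> < 1" and \<nu>: "0 \<le> \<nu>" "\<nu> \<le> \<theta>"
    and A: "pos_def (L + \<epsilon> *\<^sub>R mat 1)" and B: "pos_def (R + \<epsilon> *\<^sub>R mat 1)" and K: "0 < K"
    and AK: "\<And>x. x \<bullet> ((L + \<epsilon> *\<^sub>R mat 1) *v x) \<le> K * (norm x)\<^sup>2"
    and BK: "\<And>x. x \<bullet> ((R + \<epsilon> *\<^sub>R mat 1) *v x) \<le> K * (norm x)\<^sup>2"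
  shows "(1 - \<theta>) / (2 * K\<^sup>2) * (norm (R - L))\<^sup>2 * \<bar>\<nu> - \<theta>\<bar>
    \<le> J_inf_inner \<theta> \<epsilon> L R \<nu> - J_inf_inner \<theta> \<epsilon> L R \<theta>"
proof -
  define a b where "a = ln (det (L + \<epsilon> *\<^sub>R mat 1))" and "b = ln (det (R + \<epsilon> *\<^sub>R mat 1))"
  define w where "w = (1 - \<theta>) / (1 - \<nu>)"
  define m where "m = ln (det ((1 - w) *\<^sub>R (L + \<epsilon> *\<^sub>R mat 1) + w *\<^sub>R (R + \<epsilon> *\<^sub>R mat 1)))"
  define N where "N = (norm (R - L))\<^sup>2 / (2 * K\<^sup>2)"
  have N: "0 \<le> N" by (simp add: N_def)
  have w: "0 \<le> w" "w \<le> 1" using theta \<nu> by (auto simp: w_def)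
  have ww: "(1 - \<nu>) * w = 1 - \<theta>" using theta \<nu> by (simp add: w_def)
  have "(1 - w) * a + w * b + w * (1 - w) * N \<le> m"
    using ln_det_strongly_concave[OF A B K AK BK w] by (simp add: a_def b_def m_def N_def)
  hence "(1 - \<nu>) * ((1 - w) * a + w * b + w * (1 - w) * N) \<le> (1 - \<nu>) * m"
    using theta \<nu> by (intro mult_left_mono) auto
  moreover have "(1 - \<nu>) * ((1 - w) * a + w * b + w * (1 - w) * N)
      = (1 - \<nu> - (1 - \<nu>) * w) * a + ((1 - \<nu>) * w) * b + ((1 - \<nu>) * w) * (1 - w) * N"
    by (simp add: algebra_simps)
  ultimately have *: "(\<theta> - \<nu>) * a + (1 - \<theta>) * b + (1 - \<theta>) * (1 - w) * N \<le> (1 - \<nu>) * m"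
    unfolding ww by simp
  have "\<theta> - \<nu> \<le> 1 - w"
  proof -
    have "(\<theta> - \<nu>) * (1 - \<nu>) \<le> \<theta> - \<nu>" using \<nu> theta by (intro mult_left_le) auto
    thus ?thesis using \<nu> theta by (simp add: w_def field_simps)
  qed
  hence "(1 - \<theta>) * N * (\<theta> - \<nu>) \<le> (1 - \<theta>) * N * (1 - w)"
    using theta N by (intro mult_left_mono) auto
  moreover have "J_inf_inner \<theta> \<epsilon> L R \<nu> = \<nu> * a + (1 - \<nu>) * m"
    using J_inf_inner_left[OF theta \<nu>(2), of \<epsilon> L R] by (simp add: a_def m_def w_def)
  moreover have "J_inf_inner \<theta> \<epsilon> L R \<theta> = \<theta> * a + (1 - \<theta>) * b"
    by (simp add: J_inf_inner_def Sigma_left_def Sigma_right_def a_def b_def)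
  moreover have "(1 - \<theta>) / (2 * K\<^sup>2) * (norm (R - L))\<^sup>2 * \<bar>\<nu> - \<theta>\<bar> = (1 - \<theta>) * N * (\<theta> - \<nu>)"
    using \<nu> by (simp add: N_def)
  ultimately show ?thesis using * by (simp add: algebra_simps)
qed

lemma J_inf_inner_lower:
  fixes L R :: "real^'q::finite^'q"
  assumes theta: "0 < \<theta>" "\<theta> < 1" and \<nu>: "0 \<le> \<nu>" "\<nu> \<le> 1"
    and A: "pos_def (L + \<epsilon> *\<^sub>R mat 1)" and B: "pos_def (R + \<epsilon> *\<^sub>R mat 1)" and K: "0 < K"
    and AK: "\<And>x. x \<bullet> ((L + \<epsilon> *\<^sub>R mat 1) *v x) \<le> K * (norm x)\<^sup>2"
    and BK: "\<And>x. x \<bullet> ((R + \<epsilon> *\<^sub>R mat 1) *v x) \<le> K * (norm x)\<^sup>2"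
  shows "min \<theta> (1 - \<theta>) / (2 * K\<^sup>2) * (norm (R - L))\<^sup>2 * \<bar>\<nu> - \<theta>\<bar>
    \<le> J_inf_inner \<theta> \<epsilon> L R \<nu> - J_inf_inner \<theta> \<epsilon> L R \<theta>"
proof -
  have weaken: "min \<theta> (1 - \<theta>) / (2 * K\<^sup>2) * (norm (R - L))\<^sup>2 * \<bar>\<nu> - \<theta>\<bar>
      \<le> c / (2 * K\<^sup>2) * (norm (R - L))\<^sup>2 * \<bar>\<nu> - \<theta>\<bar>" if "min \<theta> (1 - \<theta>) \<le> c" for c
    using that by (intro mult_right_mono divide_right_mono) auto
  show ?thesis
  proof (cases "\<nu> \<le> \<theta>")
    case True
    show ?thesis
      by (rule order_trans[OF weaken J_inf_inner_lower_left[OF theta \<nu>(1) True A B K AK BK]]) simp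
  next
    case False
    have "(1 - (1 - \<theta>)) / (2 * K\<^sup>2) * (norm (L - R))\<^sup>2 * \<bar>(1 - \<nu>) - (1 - \<theta>)\<bar>
      \<le> J_inf_inner (1 - \<theta>) \<epsilon> R L (1 - \<nu>) - J_inf_inner (1 - \<theta>) \<epsilon> R L (1 - \<theta>)"
      using theta \<nu> False by (intro J_inf_inner_lower_left[OF _ _ _ _ B A K BK AK]) auto
    hence "\<theta> / (2 * K\<^sup>2) * (norm (R - L))\<^sup>2 * \<bar>\<nu> - \<theta>\<bar>
      \<le> J_inf_inner \<theta> \<epsilon> L R \<nu> - J_inf_inner \<theta> \<epsilon> L R \<theta>"
      by (simp add: J_inf_inner_mirror[of \<theta>] norm_minus_commute abs_minus_commute)
    from order_trans[OF weaken this] show ?thesis by simp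
  qed
qed

text \<open>\<^term>\<open>1 - \<nu>\<close> times the log-determinant is a perspective of \<open>ln det\<close> along an affine matrix path,
  so strict concavity is inherited with reweighted coefficients.\<close>

lemma J_inf_inner_strictly_concave_left:
  fixes L R :: "real^'q::finite^'q"
  assumes theta: "0 < \<theta>" "\<theta> < 1" and "L \<noteq> R"
    and A: "pos_def (L + \<epsilon> *\<^sub>R mat 1)" and B: "pos_def (R + \<epsilon> *\<^sub>R mat 1)"
  shows "strictly_concave_on {0<..<\<theta>} (J_inf_inner \<theta> \<epsilon> L R)"
  unfolding strictly_concave_on_def
proof (intro conjI ballI allI impI)
  show "convex {0<..<\<theta>}" by simp
next
  fix x y s :: real assume x: "x \<in> {0<..<\<theta>}" and y: "y \<in> {0<..<\<theta>}" and s: "x \<noteq> y \<and> 0 < s \<and> s < 1"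
  define z where "z = (1 - s) * x + s * y"
  have z: "0 < z" "z < \<theta>"
  proof -
    show "0 < z" using x y s by (simp add: z_def add_pos_pos)
    have "(1 - s) * x + s * y < (1 - s) * \<theta> + s * \<theta>" using x y s by (intro add_strict_mono) auto
    thus "z < \<theta>" by (simp add: z_def algebra_simps)
  qed
  define w where "w \<nu> = (1 - \<theta>) / (1 - \<nu>)" for \<nu>
  let ?A = "L + \<epsilon> *\<^sub>R mat 1" and ?B = "R + \<epsilon> *\<^sub>R mat 1"
  define X where "X \<nu> = (1 - w \<nu>) *\<^sub>R ?A + w \<nu> *\<^sub>R ?B" for \<nu>
  have X_pd: "pos_def (X \<nu>)" if "\<nu> < \<theta>" for \<nu>
    unfolding X_def using theta that by (intro pos_def_combine A B) (auto simp: w_def)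
  have J: "J_inf_inner \<theta> \<epsilon> L R \<nu> = \<nu> * ln (det ?A) + (1 - \<nu>) * ln (det (X \<nu>))" if "\<nu> < \<theta>" for \<nu>
    using J_inf_inner_left[OF theta, of \<nu> \<epsilon> L R] that by (simp add: X_def w_def)
  have X_alt: "X \<nu> = ?A + w \<nu> *\<^sub>R (R - L)" for \<nu> by (simp add: X_def algebra_simps)
  have "X x \<noteq> X y" using \<open>L \<noteq> R\<close> s x y theta by (auto simp: X_alt w_def)
  \<comment> \<open>The weights 1 - s and s are multiplied by the lengths 1 - x and 1 - y and
    renormalized by their total 1 - z. Since (1 - \<nu>) w(\<nu>) = 1 - \<theta> is constant, these
    new weights mix \<open>w x\<close> and \<open>w y\<close> into exactly
    \<open>w z\<close>.\<close>
  define p where "p = s * (1 - y) / (1 - z)"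
  have z1: "0 < 1 - z" using z theta by simp
  have zs: "1 - z = (1 - s) * (1 - x) + s * (1 - y)" by (simp add: z_def algebra_simps)
  have p1: "1 - p = (1 - s) * (1 - x) / (1 - z)" using z1 zs by (simp add: p_def field_simps)
  have p: "0 < p" "p < 1"
  proof -
    show "0 < p" using s y theta z1 by (simp add: p_def)
    have "0 < 1 - p" unfolding p1 using s x theta z1 by simp
    thus "p < 1" by simp
  qed
  have wmix: "(1 - p) * w x + p * w y = w z"
  proof -
    have "(1 - p) * w x = (1 - s) * ((1 - \<theta>) / (1 - z))"
      unfolding p1 using x theta by (simp add: w_def)
    moreover have "p * w y = s * ((1 - \<theta>) / (1 - z))"
      using y theta by (simp add: p_def w_def)
    ultimately have "(1 - p) * w x + p * w y = ((1 - s) + s) * ((1 - \<theta>) / (1 - z))"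
      by (simp only: distrib_right)
    thus ?thesis by (simp add: w_def)
  qed
  have "(1 - p) *\<^sub>R X x + p *\<^sub>R X y = ?A + ((1 - p) * w x + p * w y) *\<^sub>R (R - L)"
    unfolding X_alt by (simp add: algebra_simps)
  hence Xmix: "(1 - p) *\<^sub>R X x + p *\<^sub>R X y = X z" by (simp add: wmix X_alt)
  have "(1 - p) * ln (det (X x)) + p * ln (det (X y)) < ln (det (X z))"
    using ln_det_strictly_concave[OF X_pd X_pd \<open>X x \<noteq> X y\<close> p] x y by (simp add: Xmix)
  hence "(1 - z) * ((1 - p) * ln (det (X x)) + p * ln (det (X y))) < (1 - z) * ln (det (X z))"
    using z1 by simp
  moreover have "(1 - z) * ((1 - p) * ln (det (X x)) + p * ln (det (X y)))
      = ((1 - z) * (1 - p)) * ln (det (X x)) + ((1 - z) * p) * ln (det (X y))" by (simp add: algebra_simps)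
  moreover have "(1 - z) * (1 - p) = (1 - s) * (1 - x)" unfolding p1 using z1 by simp
  moreover have "(1 - z) * p = s * (1 - y)" using z1 by (simp add: p_def)
  ultimately have "(1 - s) * (1 - x) * ln (det (X x)) + s * (1 - y) * ln (det (X y)) < (1 - z) * ln (det (X z))"
    by simp
  moreover have "z * ln (det ?A) = (1 - s) * (x * ln (det ?A)) + s * (y * ln (det ?A))"
    by (simp add: z_def algebra_simps)
  ultimately have "(1 - s) * J_inf_inner \<theta> \<epsilon> L R x + s * J_inf_inner \<theta> \<epsilon> L R y < J_inf_inner \<theta> \<epsilon> L R z"
    using x y z by (simp add: J distrib_left mult.assoc)
  thus "(1 - s) * J_inf_inner \<theta> \<epsilon> L R x + s * J_inf_inner \<theta> \<epsilon> L R y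
      < J_inf_inner \<theta> \<epsilon> L R ((1 - s) * x + s * y)" by (simp add: z_def)
qed

lemma J_inf_inner_strictly_concave_right:
  fixes L R :: "real^'q::finite^'q"
  assumes theta: "0 < \<theta>" "\<theta> < 1" and "L \<noteq> R"
    and A: "pos_def (L + \<epsilon> *\<^sub>R mat 1)" and B: "pos_def (R + \<epsilon> *\<^sub>R mat 1)"
  shows "strictly_concave_on {\<theta><..<1} (J_inf_inner \<theta> \<epsilon> L R)"
proof -
  have "strictly_concave_on {0<..<1 - \<theta>} (J_inf_inner (1 - \<theta>) \<epsilon> R L)"
    using theta \<open>L \<noteq> R\<close> A B by (intro J_inf_inner_strictly_concave_left) auto
  hence *: "(1 - t) * J_inf_inner (1 - \<theta>) \<epsilon> R L (1 - x) + t * J_inf_inner (1 - \<theta>) \<epsilon> R L (1 - y)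
      < J_inf_inner (1 - \<theta>) \<epsilon> R L ((1 - t) * (1 - x) + t * (1 - y))"
    if "x \<in> {\<theta><..<1}" "y \<in> {\<theta><..<1}" "x \<noteq> y" "0 < t" "t < 1" for x y t
    using that by (auto simp: strictly_concave_on_def)
  have "1 - ((1 - t) * x + t * y) = (1 - t) * (1 - x) + t * (1 - y)" for t x y :: real
    by (simp add: algebra_simps)
  thus ?thesis unfolding strictly_concave_on_def J_inf_inner_mirror[of \<theta>] using * by simp
qed

section \<open>Continuity up to the endpoints, and the cusp\<close>

lemma continuous_on_Sigma_left:
  assumes "0 < \<theta>"
  shows "continuous_on S (Sigma_left \<theta> L R)"
proof -
  have "continuous_on S (\<lambda>\<nu>. (1 - max 0 (\<nu> - \<theta>) / max \<nu> \<theta>) *\<^sub>R L + (max 0 (\<nu> - \<theta>) / max \<nu> \<theta>) *\<^sub>R R)"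
    using assms by (intro continuous_intros) (auto simp: max_def)
  moreover have "Sigma_left \<theta> L R
      = (\<lambda>\<nu>. (1 - max 0 (\<nu> - \<theta>) / max \<nu> \<theta>) *\<^sub>R L + (max 0 (\<nu> - \<theta>) / max \<nu> \<theta>) *\<^sub>R R)"
    by (rule ext) (rule Sigma_left_combination(1)[OF assms])
  ultimately show ?thesis by simp
qed

lemma Sigma_left_pos_def:
  assumes "0 < \<theta>" "pos_def (L + \<epsilon> *\<^sub>R mat 1)" "pos_def (R + \<epsilon> *\<^sub>R mat 1)"
  shows "pos_def (Sigma_left \<theta> L R \<nu> + \<epsilon> *\<^sub>R mat 1)"
  unfolding Sigma_left_combination(1)[OF assms(1)] regularized_combination
  using Sigma_left_combination(2,3)[OF assms(1)] by (intro pos_def_combine assms)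

lemma continuous_on_J_inf_inner:
  fixes L R :: "real^'q::finite^'q"
  assumes theta: "0 < \<theta>" "\<theta> < 1"
    and A: "pos_def (L + \<epsilon> *\<^sub>R mat 1)" and B: "pos_def (R + \<epsilon> *\<^sub>R mat 1)"
  shows "continuous_on S (J_inf_inner \<theta> \<epsilon> L R)"
proof -
  have c: "continuous_on S (\<lambda>\<nu>. ln (det (Sigma_left \<theta> L R \<nu> + \<epsilon> *\<^sub>R mat 1)))"
    if "0 < \<theta>" "pos_def (L + \<epsilon> *\<^sub>R mat 1)" "pos_def (R + \<epsilon> *\<^sub>R mat 1)"
    for S \<theta> and L R :: "real^'q^'q"
    using pos_def_det_pos[OF Sigma_left_pos_def[OF that]]
    by (intro continuous_on_ln continuous_on_compose2[OF continuous_on_det[of UNIV]] continuous_intros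
        continuous_on_Sigma_left that) (auto simp: less_imp_neq[symmetric])
  have "continuous_on S (\<lambda>\<nu>. ln (det (Sigma_left (1 - \<theta>) R L (1 - \<nu>) + \<epsilon> *\<^sub>R mat 1)))"
    using theta A B by (intro continuous_on_compose2[OF c[of "1 - \<theta>" R L UNIV]] continuous_intros) auto
  with c[OF theta(1) A B, of S] show ?thesis unfolding J_inf_inner_def Sigma_right_mirror
    by (intro continuous_on_add continuous_on_mult continuous_on_diff continuous_on_const continuous_on_id)
qed

text \<open>The inner formula is continuous on the whole line, because both matrices are convex
  combinations of the limits for every real \<nu>. The one-sided limits at 0 and 1 are therefore its
  values there, and the case distinction disappears.\<close>

lemma J_inf_eq_inner:
  fixes L R :: "real^'q::finite^'q"
  assumes theta: "0 < \<theta>" "\<theta> < 1"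
    and A: "pos_def (L + \<epsilon> *\<^sub>R mat 1)" and B: "pos_def (R + \<epsilon> *\<^sub>R mat 1)"
  shows "J_inf \<theta> \<epsilon> L R = J_inf_inner \<theta> \<epsilon> L R"
proof
  fix \<nu>
  have "isCont (J_inf_inner \<theta> \<epsilon> L R) x" for x
    using continuous_on_J_inf_inner[OF assms, of UNIV] by (simp add: continuous_on_eq_continuous_at)
  hence lim: "(J_inf_inner \<theta> \<epsilon> L R \<longlongrightarrow> J_inf_inner \<theta> \<epsilon> L R x) (at x within S)" for x S
    by (metis continuous_at_imp_continuous_at_within continuous_within)
  have "Lim (at_right 0) (J_inf_inner \<theta> \<epsilon> L R) = J_inf_inner \<theta> \<epsilon> L R 0"
    "Lim (at_left 1) (J_inf_inner \<theta> \<epsilon> L R) = J_inf_inner \<theta> \<epsilon> L R 1"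
    by (intro tendsto_Lim lim; simp)+
  thus "J_inf \<theta> \<epsilon> L R \<nu> = J_inf_inner \<theta> \<epsilon> L R \<nu>" by (simp add: J_inf_def)
qed

text \<open>Difference quotients at p are at least c from the right and at most - c from the left,
  so they have no common limit.\<close>

lemma cusp_not_differentiable:
  fixes f :: "real \<Rightarrow> real"
  assumes lower: "\<And>x. a \<le> x \<Longrightarrow> x \<le> b \<Longrightarrow> c * \<bar>x - p\<bar> \<le> f x - f p" and p: "a < p" "p < b" and c: "0 < c"
  shows "\<not> f differentiable at p"
proof
  assume "f differentiable at p"
  then obtain D where "(f has_real_derivative D) (at p)" by (auto simp: real_differentiable_def)
  hence D: "((\<lambda>x. (f x - f p) / (x - p)) \<longlongrightarrow> D) (at p)" by (simp add: has_field_derivative_iff)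
  have "c \<le> D"
  proof (rule tendsto_lowerbound)
    show "((\<lambda>x. (f x - f p) / (x - p)) \<longlongrightarrow> D) (at_right p)"
      using D by (rule tendsto_within_subset) simp
    show "\<forall>\<^sub>F x in at_right p. c \<le> (f x - f p) / (x - p)"
      using eventually_at_right_less[of p] eventually_at_right_real[OF p(2)]
    proof eventually_elim
      case (elim x)
      thus ?case using lower[of x] p by (simp add: pos_le_divide_eq)
    qed
  qed simp
  moreover have "D \<le> - c"
  proof (rule tendsto_upperbound)
    show "((\<lambda>x. (f x - f p) / (x - p)) \<longlongrightarrow> D) (at_left p)"
      using D by (rule tendsto_within_subset) simp
    show "\<forall>\<^sub>F x in at_left p. (f x - f p) / (x - p) \<le> - c"
      using eventually_at_left_real[OF p(1)]
    proof eventually_elim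
      case (elim x)
      thus ?case using lower[of x] p by (simp add: neg_divide_le_eq algebra_simps)
    qed
  qed simp
  ultimately show False using c by simp
qed

section \<open>Evaluating the spectral bounds\<close>

text \<open>Every block in \<open>I_br\<close> lies on one side of \<theta>, so each limsup is a
  limit, and the blocks (0, \<theta>) and (\<theta>, 1) realize both values. Finiteness is what
  reduces the extended-real cusp inequality to a real one.\<close>

lemma M_bound_eq:
  fixes y :: "nat \<Rightarrow> nat \<Rightarrow> real^'q::finite"
  assumes theta: "0 < \<theta>" "\<theta> < 1"
    and left: "\<And>a b. 0 \<le> a \<Longrightarrow> a < b \<Longrightarrow> b \<le> \<theta> \<Longrightarrow> (\<lambda>n. Sigma_hat y n a b) \<longlonglongrightarrow> L"
    and right: "\<And>a b. \<theta> \<le> a \<Longrightarrow> a < b \<Longrightarrow> b \<le> 1 \<Longrightarrow> (\<lambda>n. Sigma_hat y n a b) \<longlonglongrightarrow> R"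
  shows "M_bound y \<theta> = ereal (max (op_norm L) (op_norm R))"
proof -
  have lim: "limsup (\<lambda>n. ereal (op_norm (Sigma_hat y n a b))) = ereal (op_norm S)"
    if "(\<lambda>n. Sigma_hat y n a b) \<longlonglongrightarrow> S" for a b S
    using tendsto_op_norm[OF that] by (intro lim_imp_Limsup) auto
  have l: "limsup (\<lambda>n. ereal (op_norm (Sigma_hat y n s \<theta>))) = ereal (op_norm L)" if "0 \<le> s" "s < \<theta>" for s
    using that by (intro lim left) auto
  have r: "limsup (\<lambda>n. ereal (op_norm (Sigma_hat y n \<theta> s))) = ereal (op_norm R)" if "\<theta> < s" "s \<le> 1" for s
    using that by (intro lim right) auto
  show ?thesis unfolding M_bound_def
  proof (rule antisym)
    show "(SUP (a, b)\<in>I_br \<theta>. limsup (\<lambda>n. ereal (op_norm (Sigma_hat y n a b))))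
        \<le> ereal (max (op_norm L) (op_norm R))"
      by (intro SUP_least) (auto simp: I_br_def l r)
    have "ereal (op_norm L) \<le> (SUP (a, b)\<in>I_br \<theta>. limsup (\<lambda>n. ereal (op_norm (Sigma_hat y n a b))))"
      using theta l[of 0] by (intro SUP_upper2[of "(0, \<theta>)"]) (auto simp: I_br_def)
    moreover have "ereal (op_norm R) \<le> (SUP (a, b)\<in>I_br \<theta>. limsup (\<lambda>n. ereal (op_norm (Sigma_hat y n a b))))"
      using theta r[of 1] by (intro SUP_upper2[of "(\<theta>, 1)"]) (auto simp: I_br_def)
    ultimately show "ereal (max (op_norm L) (op_norm R))
        \<le> (SUP (a, b)\<in>I_br \<theta>. limsup (\<lambda>n. ereal (op_norm (Sigma_hat y n a b))))"
      by (simp add: max_def)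
  qed
qed

text \<open>Continuity of the smallest eigenvalue is avoided: eventually the empirical forms
  dominate c times the squared norm, and for fixed x this bound passes to the limit.\<close>

lemma liminf_lambda_min_pos_imp_pos_def:
  fixes S :: "real^'q::finite^'q"
  assumes S: "psd S" and lim: "(\<lambda>n. Sigma_hat y n a b) \<longlonglongrightarrow> S"
    and pos: "0 < liminf (\<lambda>n. ereal (lambda_min (Sigma_hat y n a b)))"
  shows "pos_def S"
proof -
  obtain c where c: "0 < c" "ereal c < liminf (\<lambda>n. ereal (lambda_min (Sigma_hat y n a b)))"
    using ereal_dense2[OF pos] by (metis ereal_less(2))
  have ev: "\<forall>\<^sub>F n in sequentially. c < lambda_min (Sigma_hat y n a b)"
    using less_LiminfD[OF c(2)] by simp
  have "c * (norm x)\<^sup>2 \<le> x \<bullet> (S *v x)" for x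
  proof (rule tendsto_lowerbound)
    show "(\<lambda>n. x \<bullet> (Sigma_hat y n a b *v x)) \<longlonglongrightarrow> x \<bullet> (S *v x)"
      unfolding inner_vec_def matrix_vector_mult_def using lim
      by (auto intro!: tendsto_intros)
    show "\<forall>\<^sub>F n in sequentially. c * (norm x)\<^sup>2 \<le> x \<bullet> (Sigma_hat y n a b *v x)"
      using ev
    proof eventually_elim
      case (elim n)
      have "c * (norm x)\<^sup>2 \<le> lambda_min (Sigma_hat y n a b) * (norm x)\<^sup>2"
        using elim by (intro mult_right_mono) auto
      also have "\<dots> \<le> x \<bullet> (Sigma_hat y n a b *v x)"
        using psd_Sigma_hat[of y n a b] by (intro lambda_min_le_form) (simp add: psd_def)
      finally show ?case .
    qed
  qed simp
  moreover have "0 < c * (norm x)\<^sup>2" if "x \<noteq> 0" for x :: "real^'q" using c(1) that by simp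
  ultimately show ?thesis using S unfolding pos_def_def psd_def by (meson less_le_trans)
qed

section \<open>The finite-sample objective\<close>

text \<open>Positive determinants rule out the value minus infinity, so the comparison takes place
  between real numbers.\<close>

lemma J_n_close:
  assumes \<nu>: "0 < \<nu>" "\<nu> < 1"
    and l: "0 < det (Sigma_hat y n 0 \<nu> + \<epsilon> *\<^sub>R mat 1)"
      "\<nu> * \<bar>ln (det (Sigma_hat y n 0 \<nu> + \<epsilon> *\<^sub>R mat 1)) - ln (det (Sigma_left \<theta> L R \<nu> + \<epsilon> *\<^sub>R mat 1))\<bar> < e / 2"
    and r: "0 < det (Sigma_hat y n \<nu> 1 + \<epsilon> *\<^sub>R mat 1)"
      "(1 - \<nu>) * \<bar>ln (det (Sigma_hat y n \<nu> 1 + \<epsilon> *\<^sub>R mat 1)) - ln (det (Sigma_right \<theta> L R \<nu> + \<epsilon> *\<^sub>R mat 1))\<bar> < e / 2"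
  shows "\<bar>J_n y \<epsilon> n \<nu> - ereal (J_inf \<theta> \<epsilon> L R \<nu>)\<bar> < ereal e"
proof -
  define a b c d where "a = ln (det (Sigma_hat y n 0 \<nu> + \<epsilon> *\<^sub>R mat 1))"
    and "b = ln (det (Sigma_hat y n \<nu> 1 + \<epsilon> *\<^sub>R mat 1))"
    and "c = ln (det (Sigma_left \<theta> L R \<nu> + \<epsilon> *\<^sub>R mat 1))"
    and "d = ln (det (Sigma_right \<theta> L R \<nu> + \<epsilon> *\<^sub>R mat 1))"
  have "J_n y \<epsilon> n \<nu> = ereal (\<nu> * a + (1 - \<nu>) * b)"
    using l(1) r(1) by (simp add: J_n_def log_det_def a_def b_def)
  moreover have "J_inf \<theta> \<epsilon> L R \<nu> = \<nu> * c + (1 - \<nu>) * d"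
    using \<nu> by (simp add: J_inf_def J_inf_inner_def c_def d_def)
  moreover have "\<bar>\<nu> * a + (1 - \<nu>) * b - (\<nu> * c + (1 - \<nu>) * d)\<bar> < e"
  proof -
    have "\<nu> * a + (1 - \<nu>) * b - (\<nu> * c + (1 - \<nu>) * d) = \<nu> * (a - c) + (1 - \<nu>) * (b - d)"
      by (simp add: algebra_simps)
    also have "\<bar>\<dots>\<bar> \<le> \<nu> * \<bar>a - c\<bar> + (1 - \<nu>) * \<bar>b - d\<bar>"
      using \<nu> by (intro order_trans[OF abs_triangle_ineq]) (simp add: abs_mult)
    also have "\<dots> < e" using l(2) r(2) by (simp add: a_def b_def c_def d_def)
    finally show ?thesis .
  qed
  ultimately show ?thesis by simp
qed

lemma grid_bounds: "\<nu> \<in> grid n \<Longrightarrow> 0 < \<nu> \<and> \<nu> < 1"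
  by (auto simp: grid_def)

text \<open>The weights \<nu> and 1 - \<nu> of the objective are those under which block moments
  converge uniformly, so each block falls under \<open>weighted_ln_det_uniform\<close> with w equal
  to its own length.\<close>

lemma J_n_uniform_regularized:
  fixes y :: "nat \<Rightarrow> nat \<Rightarrow> real^'q::finite"
  assumes theta: "0 < \<theta>" "\<theta> < 1"
    and left: "\<And>a b. 0 \<le> a \<Longrightarrow> a < b \<Longrightarrow> b \<le> \<theta> \<Longrightarrow> (\<lambda>n. Sigma_hat y n a b) \<longlonglongrightarrow> L"
    and right: "\<And>a b. \<theta> \<le> a \<Longrightarrow> a < b \<Longrightarrow> b \<le> 1 \<Longrightarrow> (\<lambda>n. Sigma_hat y n a b) \<longlonglongrightarrow> R"
    and psd: "psd L" "psd R" and \<epsilon>: "0 < \<epsilon>" and e: "0 < e"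
  shows "\<forall>\<^sub>F n in sequentially. \<forall>\<nu>\<in>grid n. \<bar>J_n y \<epsilon> n \<nu> - ereal (J_inf \<theta> \<epsilon> L R \<nu>)\<bar> < ereal e"
proof -
  obtain r where r: "0 < r" "\<And>w t W. 0 < w \<Longrightarrow> w \<le> 1 \<Longrightarrow> 0 \<le> t \<Longrightarrow> t \<le> 1 \<Longrightarrow> psd W \<Longrightarrow>
     w * norm (W - ((1 - t) *\<^sub>R L + t *\<^sub>R R)) < r \<Longrightarrow>
     w * \<bar>ln (det (W + \<epsilon> *\<^sub>R mat 1)) - ln (det ((1 - t) *\<^sub>R L + t *\<^sub>R R + \<epsilon> *\<^sub>R mat 1))\<bar> < e / 2"
    using weighted_ln_det_uniform[OF psd \<epsilon>, of "e/2"] e by (metis half_gt_zero)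
  \<comment> \<open>The right block is a mirrored left block, so its combination starts from
    \<open>R\<close>; the estimate is needed with the two limits exchanged.\<close>
  obtain r' where r': "0 < r'" "\<And>w t W. 0 < w \<Longrightarrow> w \<le> 1 \<Longrightarrow> 0 \<le> t \<Longrightarrow> t \<le> 1 \<Longrightarrow> psd W \<Longrightarrow>
     w * norm (W - ((1 - t) *\<^sub>R R + t *\<^sub>R L)) < r' \<Longrightarrow>
     w * \<bar>ln (det (W + \<epsilon> *\<^sub>R mat 1)) - ln (det ((1 - t) *\<^sub>R R + t *\<^sub>R L + \<epsilon> *\<^sub>R mat 1))\<bar> < e / 2"
    using weighted_ln_det_uniform[OF psd(2,1) \<epsilon>, of "e/2"] e by (metis half_gt_zero)
  have pos: "0 < min r r'" using r r' by simp
  have "\<forall>\<^sub>F n in sequentially. \<forall>\<nu>\<in>grid n.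
      \<nu> * norm (Sigma_hat y n 0 \<nu> - Sigma_left \<theta> L R \<nu>) < min r r' \<and>
      (1 - \<nu>) * norm (Sigma_hat y n \<nu> 1 - Sigma_right \<theta> L R \<nu>) < min r r'"
    by (rule block_moments_uniform[OF theta left right pos])
  thus ?thesis
  proof eventually_elim
    case (elim n)
    show ?case
    proof
      fix \<nu> assume g: "\<nu> \<in> grid n"
      have \<nu>: "0 < \<nu>" "\<nu> < 1" using grid_bounds[OF g] by auto
      have th: "0 < 1 - \<theta>" using theta by simp
      obtain t where t: "Sigma_left \<theta> L R \<nu> = (1 - t) *\<^sub>R L + t *\<^sub>R R" "0 \<le> t" "t \<le> 1"
        using Sigma_left_combination[OF theta(1), where \<nu> = \<nu>] by blast
      obtain t' where t': "Sigma_right \<theta> L R \<nu> = (1 - t') *\<^sub>R R + t' *\<^sub>R L" "0 \<le> t'" "t' \<le> 1"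
        using Sigma_left_combination[OF th, where \<nu> = "1 - \<nu>"] unfolding Sigma_right_mirror by blast
      have near: "\<nu> * norm (Sigma_hat y n 0 \<nu> - Sigma_left \<theta> L R \<nu>) < r"
        "(1 - \<nu>) * norm (Sigma_hat y n \<nu> 1 - Sigma_right \<theta> L R \<nu>) < r'" using elim g by auto
      have det: "0 < det (Sigma_hat y n a b + \<epsilon> *\<^sub>R mat 1)" for a b
        by (intro pos_def_det_pos psd_add_scaled_id_pos_def psd_Sigma_hat \<epsilon>)
      have "\<nu> * \<bar>ln (det (Sigma_hat y n 0 \<nu> + \<epsilon> *\<^sub>R mat 1)) - ln (det (Sigma_left \<theta> L R \<nu> + \<epsilon> *\<^sub>R mat 1))\<bar> < e / 2"
        using near(1) \<nu> t(2,3) psd_Sigma_hat unfolding t(1) by (intro r(2)) auto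
      moreover have "(1 - \<nu>) * \<bar>ln (det (Sigma_hat y n \<nu> 1 + \<epsilon> *\<^sub>R mat 1)) - ln (det (Sigma_right \<theta> L R \<nu> + \<epsilon> *\<^sub>R mat 1))\<bar> < e / 2"
        using near(2) \<nu> t'(2,3) psd_Sigma_hat unfolding t'(1) by (intro r'(2)) auto
      ultimately show "\<bar>J_n y \<epsilon> n \<nu> - ereal (J_inf \<theta> \<epsilon> L R \<nu>)\<bar> < ereal e"
        using \<nu> det by (intro J_n_close) auto
    qed
  qed
qed

text \<open>On the trimmed grid both weights are at least \<delta>, so the weighted convergence can
  be divided by \<delta> and becomes convergence of the block moments themselves. Positive definite
  limits then keep the determinants positive.\<close>

lemma J_n_uniform_trimmed:
  fixes y :: "nat \<Rightarrow> nat \<Rightarrow> real^'q::finite"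
  assumes theta: "0 < \<theta>" "\<theta> < 1"
    and left: "\<And>a b. 0 \<le> a \<Longrightarrow> a < b \<Longrightarrow> b \<le> \<theta> \<Longrightarrow> (\<lambda>n. Sigma_hat y n a b) \<longlonglongrightarrow> L"
    and right: "\<And>a b. \<theta> \<le> a \<Longrightarrow> a < b \<Longrightarrow> b \<le> 1 \<Longrightarrow> (\<lambda>n. Sigma_hat y n a b) \<longlonglongrightarrow> R"
    and A: "pos_def (L + \<epsilon> *\<^sub>R mat 1)" and B: "pos_def (R + \<epsilon> *\<^sub>R mat 1)"
    and \<delta>: "0 < \<delta>" and e: "0 < e"
  shows "\<forall>\<^sub>F n in sequentially. \<forall>\<nu>\<in>trimmed_grid \<delta> n. \<bar>J_n y \<epsilon> n \<nu> - ereal (J_inf \<theta> \<epsilon> L R \<nu>)\<bar> < ereal e"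
proof -
  let ?A = "L + \<epsilon> *\<^sub>R mat 1" and ?B = "R + \<epsilon> *\<^sub>R mat 1"
  obtain r where r: "0 < r" "\<And>t Y. 0 \<le> t \<Longrightarrow> t \<le> 1 \<Longrightarrow> norm (Y - ((1 - t) *\<^sub>R ?A + t *\<^sub>R ?B)) < r \<Longrightarrow>
     0 < det Y \<and> \<bar>ln (det Y) - ln (det ((1 - t) *\<^sub>R ?A + t *\<^sub>R ?B))\<bar> < e / 2"
    using ln_det_uniform_near_segment[OF A B, of "e/2"] e by (metis half_gt_zero)
  obtain r' where r': "0 < r'" "\<And>t Y. 0 \<le> t \<Longrightarrow> t \<le> 1 \<Longrightarrow> norm (Y - ((1 - t) *\<^sub>R ?B + t *\<^sub>R ?A)) < r' \<Longrightarrow>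
     0 < det Y \<and> \<bar>ln (det Y) - ln (det ((1 - t) *\<^sub>R ?B + t *\<^sub>R ?A))\<bar> < e / 2"
    using ln_det_uniform_near_segment[OF B A, of "e/2"] e by (metis half_gt_zero)
  have pos: "0 < \<delta> * min r r'" using r r' \<delta> by simp
  have "\<forall>\<^sub>F n in sequentially. \<forall>\<nu>\<in>grid n.
      \<nu> * norm (Sigma_hat y n 0 \<nu> - Sigma_left \<theta> L R \<nu>) < \<delta> * min r r' \<and>
      (1 - \<nu>) * norm (Sigma_hat y n \<nu> 1 - Sigma_right \<theta> L R \<nu>) < \<delta> * min r r'"
    by (rule block_moments_uniform[OF theta left right pos])
  thus ?thesis
  proof eventually_elim
    case (elim n)
    show ?case
    proof
      fix \<nu> assume g: "\<nu> \<in> trimmed_grid \<delta> n"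
      have \<nu>: "0 < \<nu>" "\<nu> < 1" "\<delta> \<le> \<nu>" "\<delta> \<le> 1 - \<nu>"
        using g grid_bounds[of \<nu> n] by (auto simp: trimmed_grid_def)
      have th: "0 < 1 - \<theta>" using theta by simp
      obtain t where t: "Sigma_left \<theta> L R \<nu> = (1 - t) *\<^sub>R L + t *\<^sub>R R" "0 \<le> t" "t \<le> 1"
        using Sigma_left_combination[OF theta(1), where \<nu> = \<nu>] by blast
      obtain t' where t': "Sigma_right \<theta> L R \<nu> = (1 - t') *\<^sub>R R + t' *\<^sub>R L" "0 \<le> t'" "t' \<le> 1"
        using Sigma_left_combination[OF th, where \<nu> = "1 - \<nu>"] unfolding Sigma_right_mirror by blast
      have near: "\<nu> * norm (Sigma_hat y n 0 \<nu> - Sigma_left \<theta> L R \<nu>) < \<delta> * min r r'"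
        "(1 - \<nu>) * norm (Sigma_hat y n \<nu> 1 - Sigma_right \<theta> L R \<nu>) < \<delta> * min r r'"
        using elim g by (auto simp: trimmed_grid_def)
      have cancel: "X < min r r'" if "\<delta> \<le> w" "w * X < \<delta> * min r r'" "0 \<le> X" for w X
      proof -
        have "\<delta> * X \<le> w * X" using that by (intro mult_right_mono) auto
        hence "\<delta> * X < \<delta> * min r r'" using that by linarith
        thus ?thesis using \<delta> by (simp only: mult_less_cancel_left_pos)
      qed
      have weight: "w * X < e / 2" if "0 < w" "w < 1" "X < e / 2" "0 \<le> X" for w X :: real
        using that mult_left_le_one_le[of X w] by linarith
      have "norm (Sigma_hat y n 0 \<nu> - Sigma_left \<theta> L R \<nu>) < r"
        using cancel[OF \<nu>(3) near(1)] by simp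
      hence "0 < det (Sigma_hat y n 0 \<nu> + \<epsilon> *\<^sub>R mat 1) \<and>
        \<bar>ln (det (Sigma_hat y n 0 \<nu> + \<epsilon> *\<^sub>R mat 1)) - ln (det (Sigma_left \<theta> L R \<nu> + \<epsilon> *\<^sub>R mat 1))\<bar> < e / 2"
        using t(2,3) unfolding t(1) regularized_combination
        by (intro r(2)) (auto simp: algebra_simps)
      moreover have "norm (Sigma_hat y n \<nu> 1 - Sigma_right \<theta> L R \<nu>) < r'"
        using cancel[OF \<nu>(4) near(2)] by simp
      hence "0 < det (Sigma_hat y n \<nu> 1 + \<epsilon> *\<^sub>R mat 1) \<and>
        \<bar>ln (det (Sigma_hat y n \<nu> 1 + \<epsilon> *\<^sub>R mat 1)) - ln (det (Sigma_right \<theta> L R \<nu> + \<epsilon> *\<^sub>R mat 1))\<bar> < e / 2"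
        using t'(2,3) unfolding t'(1) regularized_combination
        by (intro r'(2)) (auto simp: algebra_simps)
      ultimately show "\<bar>J_n y \<epsilon> n \<nu> - ereal (J_inf \<theta> \<epsilon> L R \<nu>)\<bar> < ereal e"
        using \<nu> by (intro J_n_close weight) auto
    qed
  qed
qed

section \<open>From uniform convergence to consistency\<close>

text \<open>Over an empty grid the supremum in the extended reals is minus infinity, so nonemptiness
  supplies the lower bound 0.\<close>

lemma SUP_abs_tendsto_0:
  fixes f :: "nat \<Rightarrow> 'a \<Rightarrow> ereal"
  assumes unif: "\<And>e. 0 < e \<Longrightarrow> \<forall>\<^sub>F n in sequentially. \<forall>x\<in>G n. \<bar>f n x\<bar> < ereal e"
    and ne: "\<forall>\<^sub>F n in sequentially. G n \<noteq> {}"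
  shows "(\<lambda>n. SUP x\<in>G n. \<bar>f n x\<bar>) \<longlonglongrightarrow> 0"
proof (rule order_tendstoI)
  fix a :: ereal assume "a < 0"
  show "\<forall>\<^sub>F n in sequentially. a < (SUP x\<in>G n. \<bar>f n x\<bar>)"
    using ne
  proof eventually_elim
    case (elim n)
    then obtain x where "x \<in> G n" by blast
    hence "0 \<le> (SUP x\<in>G n. \<bar>f n x\<bar>)" by (intro SUP_upper2[of x]) auto
    thus ?case using \<open>a < 0\<close> by (rule less_le_trans[rotated])
  qed
next
  fix a :: ereal assume "0 < a"
  then obtain e where e: "0 < e" "ereal e < a" using ereal_dense2 by (metis ereal_less(2))
  show "\<forall>\<^sub>F n in sequentially. (SUP x\<in>G n. \<bar>f n x\<bar>) < a"
    using unif[OF e(1)]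
  proof eventually_elim
    case (elim n)
    hence "(SUP x\<in>G n. \<bar>f n x\<bar>) \<le> ereal e" by (intro SUP_least) (auto intro: less_imp_le)
    thus ?case using e(2) by (rule le_less_trans)
  qed
qed

text \<open>The point p need not belong to the grid, so the minimizer \<open>v n\<close> is compared
  with grid points \<open>u n\<close> that tend to p; the linear lower bound then converts an excess
  in value into a distance.\<close>

lemma argmin_consistent:
  fixes f :: "nat \<Rightarrow> real \<Rightarrow> ereal" and g :: "real \<Rightarrow> real"
  assumes unif: "\<And>e. 0 < e \<Longrightarrow> \<forall>\<^sub>F n in sequentially. \<forall>x\<in>G n. \<bar>f n x - ereal (g x)\<bar> < ereal e"
    and lower: "\<And>n x. x \<in> G n \<Longrightarrow> c * \<bar>x - p\<bar> \<le> g x - g p" and c: "0 < c"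
    and cont: "isCont g p" and u: "u \<longlonglongrightarrow> p" "\<forall>\<^sub>F n in sequentially. u n \<in> G n"
    and argmin: "\<And>n. G n \<noteq> {} \<Longrightarrow> is_arg_min (f n) (\<lambda>x. x \<in> G n) (v n)"
  shows "v \<longlonglongrightarrow> p"
proof (rule tendstoI)
  fix e :: real assume e: "0 < e"
  \<comment> \<open>Three errors of size d add up: uniform closeness at \<open>v n\<close> and at
    \<open>u n\<close>, and continuity of g between \<open>u n\<close> and p.\<close>
  define d where "d = c * e / 3"
  have d: "0 < d" using c e by (simp add: d_def)
  have "(\<lambda>n. g (u n)) \<longlonglongrightarrow> g p" using cont u(1) by (rule isCont_tendsto_compose)
  from tendstoD[OF this d] have "\<forall>\<^sub>F n in sequentially. dist (g (u n)) (g p) < d" .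
  with unif[OF d] u(2) show "\<forall>\<^sub>F n in sequentially. dist (v n) p < e"
  proof eventually_elim
    case (elim n)
    have v: "v n \<in> G n" "\<not> f n (u n) < f n (v n)"
      using argmin[of n] elim(2) by (auto simp: is_arg_min_def)
    \<comment> \<open>A finite distance to a real number excludes infinite values of
      \<open>f n\<close>.\<close>
    have fin: "\<exists>a. f n x = ereal a \<and> \<bar>a - g x\<bar> < d" if "x \<in> G n" for x
      using elim(1) that by (cases "f n x") auto
    obtain a where a: "f n (u n) = ereal a" "\<bar>a - g (u n)\<bar> < d" using fin elim(2) by blast
    obtain b where b: "f n (v n) = ereal b" "\<bar>b - g (v n)\<bar> < d" using fin v(1) by blast
    have "b \<le> a" using v(2) a(1) b(1) by simp
    hence "g (v n) - g p < 3 * d" using a b elim(3) by (auto simp: dist_real_def)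
    hence "c * \<bar>v n - p\<bar> < c * e" using lower[OF v(1)] by (simp add: d_def)
    thus ?case using c by (simp add: dist_real_def)
  qed
qed

lemma grid_point_tendsto:
  assumes "0 < \<theta>" "\<theta> < 1"
  shows "(\<lambda>n. real (nat \<lfloor>\<theta> * real n\<rfloor>) / real n) \<longlonglongrightarrow> \<theta>"
    and "\<forall>\<^sub>F n in sequentially. real (nat \<lfloor>\<theta> * real n\<rfloor>) / real n \<in> grid n"
    and "\<delta> < min \<theta> (1 - \<theta>) \<Longrightarrow>
      \<forall>\<^sub>F n in sequentially. real (nat \<lfloor>\<theta> * real n\<rfloor>) / real n \<in> trimmed_grid \<delta> n"
proof -
  show lim: "(\<lambda>n. real (nat \<lfloor>\<theta> * real n\<rfloor>) / real n) \<longlonglongrightarrow> \<theta>"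
    using assms by (intro nat_floor_over_tendsto) simp
  show g: "\<forall>\<^sub>F n in sequentially. real (nat \<lfloor>\<theta> * real n\<rfloor>) / real n \<in> grid n"
    using order_tendstoD(1)[OF lim assms(1)] order_tendstoD(2)[OF lim assms(2)]
  proof eventually_elim
    case (elim n)
    define k where "k = nat \<lfloor>\<theta> * real n\<rfloor>"
    have k: "0 < real k / real n" "real k / real n < 1" using elim by (simp_all only: k_def)
    hence n: "0 < n" by (cases "n = 0") auto
    have "0 < k" "k < n" using k n by (auto simp: field_simps zero_less_divide_iff)
    thus ?case unfolding k_def[symmetric] grid_def by auto
  qed
  assume "\<delta> < min \<theta> (1 - \<theta>)"
  hence "\<delta> < \<theta>" "\<theta> < 1 - \<delta>" by auto
  from order_tendstoD(1)[OF lim this(1)] order_tendstoD(2)[OF lim this(2)] g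
  show "\<forall>\<^sub>F n in sequentially. real (nat \<lfloor>\<theta> * real n\<rfloor>) / real n \<in> trimmed_grid \<delta> n"
    by eventually_elim (auto simp: trimmed_grid_def)
qed

text \<open>The grid points tending to 1/2 eventually lie in the trimmed interval.\<close>

lemma trimmed_grid_eventually_nonempty:
  assumes "\<delta> < 1 / 2"
  shows "\<forall>\<^sub>F n in sequentially. trimmed_grid \<delta> n \<noteq> {}"
  using grid_point_tendsto(3)[of "1/2" \<delta>] assms by (auto elim: eventually_mono)

theorem theorem21:
  fixes y :: "nat \<Rightarrow> nat \<Rightarrow> real^'q::finite"
    and \<theta> \<epsilon> :: real
    and \<Sigma>\<^sub>l \<Sigma>\<^sub>r :: "real^'q^'q"
  assumes theta: "0 < \<theta>" "\<theta> < 1"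
    and eps: "0 \<le> \<epsilon>"
    and psd: "psd \<Sigma>\<^sub>l" "psd \<Sigma>\<^sub>r"
    and distinct: "\<Sigma>\<^sub>l \<noteq> \<Sigma>\<^sub>r"
    and left: "\<And>a b. 0 \<le> a \<Longrightarrow> a < b \<Longrightarrow> b \<le> \<theta> \<Longrightarrow>
                 (\<lambda>n. Sigma_hat y n a b) \<longlonglongrightarrow> \<Sigma>\<^sub>l"
    and right: "\<And>a b. \<theta> \<le> a \<Longrightarrow> a < b \<Longrightarrow> b \<le> 1 \<Longrightarrow>
                 (\<lambda>n. Sigma_hat y n a b) \<longlonglongrightarrow> \<Sigma>\<^sub>r"
    and m_pos: "\<epsilon> = 0 \<Longrightarrow> 0 < m_bound y \<theta>"
  shows
    "(strictly_concave_on {0<..<\<theta>} (J_inf \<theta> \<epsilon> \<Sigma>\<^sub>l \<Sigma>\<^sub>r) \<and>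
      strictly_concave_on {\<theta><..<1} (J_inf \<theta> \<epsilon> \<Sigma>\<^sub>l \<Sigma>\<^sub>r) \<and>
      (\<forall>\<nu>. is_arg_min (J_inf \<theta> \<epsilon> \<Sigma>\<^sub>l \<Sigma>\<^sub>r) (\<lambda>\<nu>. \<nu> \<in> {0..1}) \<nu> \<longleftrightarrow> \<nu> = \<theta>) \<and>
      \<not> J_inf \<theta> \<epsilon> \<Sigma>\<^sub>l \<Sigma>\<^sub>r differentiable at \<theta> \<and>
      (\<forall>\<nu>\<in>{0..1}.
         ereal (J_inf \<theta> \<epsilon> \<Sigma>\<^sub>l \<Sigma>\<^sub>r \<nu> - J_inf \<theta> \<epsilon> \<Sigma>\<^sub>l \<Sigma>\<^sub>r \<theta>)
         \<ge> ereal (min \<theta> (1 - \<theta>)) / (2 * (M_bound y \<theta> + ereal \<epsilon>)^2)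
            * ereal ((norm (\<Sigma>\<^sub>r - \<Sigma>\<^sub>l))^2 * \<bar>\<nu> - \<theta>\<bar>)))
     \<and>
     ((\<epsilon> > 0 \<longrightarrow>
         (\<lambda>n. SUP \<nu>\<in>grid n. \<bar>J_n y \<epsilon> n \<nu> - ereal (J_inf \<theta> \<epsilon> \<Sigma>\<^sub>l \<Sigma>\<^sub>r \<nu>)\<bar>) \<longlonglongrightarrow> 0) \<and>
      (\<epsilon> = 0 \<longrightarrow> (\<forall>\<delta>. 0 < \<delta> \<and> \<delta> < 1/2 \<longrightarrow>
         (\<lambda>n. SUP \<nu>\<in>trimmed_grid \<delta> n. \<bar>J_n y \<epsilon> n \<nu> - ereal (J_inf \<theta> \<epsilon> \<Sigma>\<^sub>l \<Sigma>\<^sub>r \<nu>)\<bar>) \<longlonglongrightarrow> 0)))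
     \<and>
     ((\<epsilon> > 0 \<longrightarrow> (\<forall>\<theta>hat.
         (\<forall>n. grid n \<noteq> {} \<longrightarrow> is_arg_min (J_n y \<epsilon> n) (\<lambda>\<nu>. \<nu> \<in> grid n) (\<theta>hat n))
         \<longrightarrow> \<theta>hat \<longlonglongrightarrow> \<theta>)) \<and>
      (\<epsilon> = 0 \<longrightarrow> (\<forall>\<delta> \<theta>hat. 0 < \<delta> \<and> \<delta> < min \<theta> (1 - \<theta>) \<and>
         (\<forall>n. trimmed_grid \<delta> n \<noteq> {} \<longrightarrow>
              is_arg_min (J_n y \<epsilon> n) (\<lambda>\<nu>. \<nu> \<in> trimmed_grid \<delta> n) (\<theta>hat n))
         \<longrightarrow> \<theta>hat \<longlonglongrightarrow> \<theta>)))"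
proof -
  let ?J = "J_inf \<theta> \<epsilon> \<Sigma>\<^sub>l \<Sigma>\<^sub>r"
  let ?A = "\<Sigma>\<^sub>l + \<epsilon> *\<^sub>R mat 1" and ?B = "\<Sigma>\<^sub>r + \<epsilon> *\<^sub>R mat 1"
  \<comment> \<open>For \<epsilon> = 0 the infimum defining m is applied to the blocks (0, \<theta>)
    and (\<theta>, 1), whose moments tend to the two limit matrices.\<close>
  have pd: "pos_def ?A \<and> pos_def ?B"
  proof (cases "\<epsilon> = 0")
    case True
    have "m_bound y \<theta> \<le> liminf (\<lambda>n. ereal (lambda_min (Sigma_hat y n 0 \<theta>)))"
      unfolding m_bound_def using theta by (intro INF_lower2[of "(0, \<theta>)"]) (auto simp: I_cut_def I_br_def)
    moreover have "m_bound y \<theta> \<le> liminf (\<lambda>n. ereal (lambda_min (Sigma_hat y n \<theta> 1)))"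
      unfolding m_bound_def using theta by (intro INF_lower2[of "(\<theta>, 1)"]) (auto simp: I_cut_def I_br_def)
    ultimately have "pos_def \<Sigma>\<^sub>l" "pos_def \<Sigma>\<^sub>r"
      using liminf_lambda_min_pos_imp_pos_def[OF psd(1) left[of 0 \<theta>]]
        liminf_lambda_min_pos_imp_pos_def[OF psd(2) right[of \<theta> 1]] theta m_pos[OF True] by auto
    thus ?thesis using True by simp
  qed (use eps psd in \<open>auto intro: psd_add_scaled_id_pos_def\<close>)
  hence A: "pos_def ?A" and B: "pos_def ?B" by auto
  have J: "?J = J_inf_inner \<theta> \<epsilon> \<Sigma>\<^sub>l \<Sigma>\<^sub>r" by (rule J_inf_eq_inner[OF theta A B])
  define M where "M = max (op_norm \<Sigma>\<^sub>l) (op_norm \<Sigma>\<^sub>r)"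
  have M: "M_bound y \<theta> = ereal M" unfolding M_def by (rule M_bound_eq[OF theta left right])
  define K where "K = M + \<epsilon>"
  have form: "x \<bullet> ((S + \<epsilon> *\<^sub>R mat 1) *v x) \<le> K * (norm x)\<^sup>2" if "op_norm S \<le> M"
    for S :: "real^'q^'q" and x
  proof -
    have "x \<bullet> ((S + \<epsilon> *\<^sub>R mat 1) *v x) = x \<bullet> (S *v x) + \<epsilon> * (norm x)\<^sup>2"
      by (simp add: matrix_vector_mult_add_rdistrib inner_add_right power2_norm_eq_inner
          flip: scaleR_matrix_vector_assoc)
    also have "x \<bullet> (S *v x) \<le> M * (norm x)\<^sup>2"
      by (rule order_trans[OF quadratic_form_le_op_norm]) (use that in \<open>auto intro: mult_right_mono\<close>)
    finally show ?thesis by (simp add: K_def algebra_simps)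
  qed
  have AK: "x \<bullet> (?A *v x) \<le> K * (norm x)\<^sup>2" and BK: "x \<bullet> (?B *v x) \<le> K * (norm x)\<^sup>2" for x
    by (auto intro!: form simp: M_def)
  \<comment> \<open>A coordinate vector has unit norm, and the form of \<open>?A\<close> at it is
    positive and at most \<open>K\<close>.\<close>
  have K: "0 < K"
  proof -
    fix i :: 'q
    have "0 < axis i (1::real) \<bullet> (?A *v axis i 1)" using A by (simp add: pos_def_def axis_eq_0_iff)
    also have "\<dots> \<le> K" using AK[of "axis i 1"] by (simp add: norm_axis_1)
    finally show "0 < K" .
  qed
  define c where "c = min \<theta> (1 - \<theta>) / (2 * K\<^sup>2) * (norm (\<Sigma>\<^sub>r - \<Sigma>\<^sub>l))\<^sup>2"
  have c: "0 < c" using theta K distinct by (simp add: c_def)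
  have lower: "c * \<bar>\<nu> - \<theta>\<bar> \<le> ?J \<nu> - ?J \<theta>" if "0 \<le> \<nu>" "\<nu> \<le> 1" for \<nu>
    unfolding J c_def by (rule J_inf_inner_lower[OF theta that A B K AK BK])
  have cont: "isCont ?J \<theta>"
    using continuous_on_J_inf_inner[OF theta A B, of UNIV] by (simp add: J continuous_on_eq_continuous_at)
  have min: "is_arg_min ?J (\<lambda>\<nu>. \<nu> \<in> {0..1}) \<nu> \<longleftrightarrow> \<nu> = \<theta>" for \<nu>
  proof
    assume "is_arg_min ?J (\<lambda>\<nu>. \<nu> \<in> {0..1}) \<nu>"
    hence "\<nu> \<in> {0..1}" "\<not> ?J \<theta> < ?J \<nu>" using theta by (auto simp: is_arg_min_def)
    hence \<nu>: "0 \<le> \<nu>" "\<nu> \<le> 1" "?J \<nu> \<le> ?J \<theta>" by auto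
    hence "c * \<bar>\<nu> - \<theta>\<bar> \<le> 0" using lower[of \<nu>] by linarith
    thus "\<nu> = \<theta>" using c by (simp add: mult_le_0_iff)
  next
    assume "\<nu> = \<theta>"
    moreover have "?J \<theta> \<le> ?J \<mu>" if "0 \<le> \<mu>" "\<mu> \<le> 1" for \<mu>
    proof -
      have "0 \<le> c * \<bar>\<mu> - \<theta>\<bar>" using c by simp
      thus ?thesis using lower[OF that] by linarith
    qed
    ultimately show "is_arg_min ?J (\<lambda>\<nu>. \<nu> \<in> {0..1}) \<nu>" using theta by (force simp: is_arg_min_def)
  qed
  have nondiff: "\<not> ?J differentiable at \<theta>"
    by (rule cusp_not_differentiable[OF lower theta c])
  \<comment> \<open>Since \<open>M_bound\<close> is the real number \<open>M\<close>, the
    denominator is a positive real and the extended-real expression is the real constant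
    \<open>c\<close> times the distance.\<close>
  have bound: "ereal (min \<theta> (1 - \<theta>)) / (2 * (M_bound y \<theta> + ereal \<epsilon>)^2)
      * ereal ((norm (\<Sigma>\<^sub>r - \<Sigma>\<^sub>l))^2 * \<bar>\<nu> - \<theta>\<bar>) \<le> ereal (?J \<nu> - ?J \<theta>)" if "\<nu> \<in> {0..1}" for \<nu>
  proof -
    have "2 * (M_bound y \<theta> + ereal \<epsilon>)^2 = ereal (2 * K\<^sup>2)"
    proof -
      have "2 * (M_bound y \<theta> + ereal \<epsilon>)^2 = ereal 2 * ereal (K\<^sup>2)" by (simp add: M K_def)
      thus ?thesis by (simp only: times_ereal.simps)
    qed
    hence "ereal (min \<theta> (1 - \<theta>)) / (2 * (M_bound y \<theta> + ereal \<epsilon>)^2)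
      * ereal ((norm (\<Sigma>\<^sub>r - \<Sigma>\<^sub>l))^2 * \<bar>\<nu> - \<theta>\<bar>) = ereal (c * \<bar>\<nu> - \<theta>\<bar>)"
      using K by (simp add: c_def del: ereal_min)
    thus ?thesis using lower that by simp
  qed
  have unif_reg: "\<forall>\<^sub>F n in sequentially. \<forall>\<nu>\<in>grid n. \<bar>J_n y \<epsilon> n \<nu> - ereal (?J \<nu>)\<bar> < ereal e"
    if "0 < \<epsilon>" "0 < e" for e
    by (rule J_n_uniform_regularized[OF theta left right psd that])
  have unif_trim: "\<forall>\<^sub>F n in sequentially. \<forall>\<nu>\<in>trimmed_grid \<delta> n. \<bar>J_n y \<epsilon> n \<nu> - ereal (?J \<nu>)\<bar> < ereal e"
    if "0 < \<delta>" "0 < e" for e \<delta>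
    by (rule J_n_uniform_trimmed[OF theta left right A B that])
  note grid_\<theta> = grid_point_tendsto[OF theta]
  have "\<forall>\<^sub>F n in sequentially. grid n \<noteq> {}"
    using grid_\<theta>(2) by (auto elim: eventually_mono)
  hence ii_reg: "(\<lambda>n. SUP \<nu>\<in>grid n. \<bar>J_n y \<epsilon> n \<nu> - ereal (?J \<nu>)\<bar>) \<longlonglongrightarrow> 0" if "0 < \<epsilon>"
    using unif_reg[OF that] by (intro SUP_abs_tendsto_0) auto
  have ii_trim: "(\<lambda>n. SUP \<nu>\<in>trimmed_grid \<delta> n. \<bar>J_n y \<epsilon> n \<nu> - ereal (?J \<nu>)\<bar>) \<longlonglongrightarrow> 0"
    if "0 < \<delta>" "\<delta> < 1 / 2" for \<delta>
    using unif_trim[OF that(1)] trimmed_grid_eventually_nonempty[OF that(2)]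
    by (intro SUP_abs_tendsto_0) auto
  have iii_reg: "\<theta>hat \<longlonglongrightarrow> \<theta>"
    if "0 < \<epsilon>" "\<forall>n. grid n \<noteq> {} \<longrightarrow> is_arg_min (J_n y \<epsilon> n) (\<lambda>\<nu>. \<nu> \<in> grid n) (\<theta>hat n)" for \<theta>hat
  proof (rule argmin_consistent[OF unif_reg[OF that(1)] _ c cont grid_\<theta>(1,2)])
    show "c * \<bar>x - \<theta>\<bar> \<le> ?J x - ?J \<theta>" if "x \<in> grid n" for n x
      using grid_bounds[OF that] by (intro lower) auto
  qed (use that in auto)
  have iii_trim: "\<theta>hat \<longlonglongrightarrow> \<theta>"
    if "0 < \<delta>" "\<delta> < min \<theta> (1 - \<theta>)"
      "\<forall>n. trimmed_grid \<delta> n \<noteq> {} \<longrightarrow> is_arg_min (J_n y \<epsilon> n) (\<lambda>\<nu>. \<nu> \<in> trimmed_grid \<delta> n) (\<theta>hat n)"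
    for \<delta> \<theta>hat
  proof (rule argmin_consistent[OF unif_trim[OF that(1)] _ c cont grid_\<theta>(1) grid_\<theta>(3)[OF that(2)]])
    show "c * \<bar>x - \<theta>\<bar> \<le> ?J x - ?J \<theta>" if "x \<in> trimmed_grid \<delta> n" for n x
      using grid_bounds[of x n] that by (intro lower) (auto simp: trimmed_grid_def)
  qed (use that in auto)
  have "strictly_concave_on {0<..<\<theta>} ?J" "strictly_concave_on {\<theta><..<1} ?J"
    unfolding J
    by (rule J_inf_inner_strictly_concave_left[OF theta distinct A B]
        J_inf_inner_strictly_concave_right[OF theta distinct A B])+
  thus ?thesis using min nondiff bound ii_reg ii_trim iii_reg iii_trim by blast
qed

end
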